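(* Let $p\in\mathbb{N}$, $p\ge 1$, let $h>0$ and let $\omega\in\mathbb{C}$ be a complex frequency with $|\omega h|\ll 1$. Then the error $\mathcal{E}^p(\omega h):=R_p(\omega h)-\cos(\omega h)$ in the discrete dispersion relation satisfies, as $\omega h\to 0$ in $\mathbb{C}$ (for fixed $p$), $$R_p(\omega h)-\cos(\omega h)=\frac{1}{2}\left[\frac{p!}{(2p)!}\right]^2\frac{(\omega h)^{2p+2}}{2p+1}+\mathcal{O}\big((\omega h)^{2p+4}\big).$$
   Context: Numerical cosine $R_p$. Consider the uniform mesh of $\mathbb{R}$ with nodes $x_j=jh$, $j\in\mathbb{Z}$, $h>0$, and let $V$ be the space of continuous functions $u:\mathbb{R}\to\mathbb{C}$ whose restriction to each $[x_j,x_{j+1}]$ is a polynomial of degree at most $p$. The degree-$p$ finite element discretization of $-u''-\omega^2u=0$ on $\mathbb{R}$ is: find $u\in V$ with $$\int_{\mathbb{R}}u'\,\overline{v}'\,dx-\omega^2\int_{\mathbb{R}}u\,\overline{v}\,dx=0\quad\text{for all compactly supported } v\in V.$$ One looks for discrete waves with discrete wave number $k_{hp}\in\mathbb{C}$, i.e. nonzero solutions with $u(x+h)=e^{ik_{hp}h}u(x)$, so that the nodal values satisfy $u(x_j)=b\,e^{ijk_{hp}h}$ for a constant $b$. Then $R_p$ is the rational function (depending only on $p$) such that, for $|\omega h|$ small, such a discrete wave exists if and only if the discrete dispersion relation $\cos(k_{hp}h)=R_p(\omega h)$ holds. The error $\mathcal{E}^p(\omega h):=R_p(\omega h)-\cos(\omega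 h)$ has the following equivalent explicit form, for $\omega h\neq0$ with $|\arg\omega|<\pi$. Put $\kappa=\omega h/2$, $N_e=\lfloor p/2\rfloor$, $N_o=\lfloor (p+1)/2\rfloor$, and $Q_m(\kappa)=J_m(\kappa)/Y_m(\kappa)$ for half-integers $m$, where $J_m,Y_m$ are the Bessel functions of the first and second kind. Then $$\mathcal{E}^p(\omega h)=\frac{\sin\omega h}{\omega h}\left\{\mathcal{E}^p_o\sin^2\left(\frac{\omega h}{2}\right)+\mathcal{E}^p_e\cos^2\left(\frac{\omega h}{2}\right)\right\}\left\{1+\frac{\sin\omega h}{2\omega h}(\mathcal{E}^p_o-\mathcal{E}^p_e)\right\}^{-1},$$ where $\mathcal{E}^p_e=\mathcal{E}^p_e(\kappa)$ and $\mathcal{E}^p_o=\mathcal{E}^p_o(\kappa)$ are given by $$\mathcal{E}^p_e(\kappa)\frac{\cos^2(\omega h/2)}{\omega h}=-Q_{2N_e+3/2}(\kappa)\{1-Q_{2N_e+3/2}(\kappa)\tan\kappa\}^{-1},$$ $$\mathcal{E}^p_o(\kappa)\frac{\sin^2(\omega h/2)}{\omega h}=-Q_{2N_o+1/2}(\kappa)\{1+Q_{2N_o+1/2}(\kappa)\cot\kappa\}^{-1}.$$ *)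

theory Defs
  imports "HOL-Analysis.Analysis" "HOL-Computational_Algebra.Computational_Algebra"
begin

definition fe_space :: "nat \<Rightarrow> real \<Rightarrow> (real \<Rightarrow> complex) set" where
  "fe_space p h =
    {u. continuous_on UNIV u \<and>
        (\<forall>j::int. \<exists>q::complex poly. degree q \<le> p \<and>
           (\<forall>x\<in>{of_int j * h..of_int (j + 1) * h}. u x = poly q (complex_of_real x)))}"

(* Elements of the space need not be differentiable at the mesh nodes, where vector_derivative
   is unspecified.  For v of compact support only finitely many nodes matter, so
   the integrals below do not depend on these values. *)
definition fe_solution :: "nat \<Rightarrow> real \<Rightarrow> complex \<Rightarrow> (real \<Rightarrow> complex) \<Rightarrow> bool" where
  "fe_solution p h \<omega> u \<longleftrightarrow>
    u \<in> fe_space p h \<and>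
    (\<forall>v\<in>fe_space p h. compact (closure {x. v x \<noteq> 0}) \<longrightarrow>
       integral UNIV (\<lambda>x. vector_derivative u (at x) * cnj (vector_derivative v (at x)))
       - \<omega>\<^sup>2 * integral UNIV (\<lambda>x. u x * cnj (v x)) = 0)"

definition discrete_wave ::
  "nat \<Rightarrow> real \<Rightarrow> complex \<Rightarrow> complex \<Rightarrow> (real \<Rightarrow> complex) \<Rightarrow> bool" where
  "discrete_wave p h \<omega> k u \<longleftrightarrow>
    fe_solution p h \<omega> u \<and> (\<exists>x. u x \<noteq> 0) \<and>
    (\<forall>x. u (x + h) = exp (\<i> * k * complex_of_real h) * u x)"

(* Rational functions are represented as total functions through a quotient in lowest terms;
   coprimality makes the function independent of the chosen quotient (its value is 0 at poles). *)
definition rational_function :: "(complex \<Rightarrow> complex) \<Rightarrow> bool" where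
  "rational_function R \<longleftrightarrow>
    (\<exists>P Q :: complex poly. Q \<noteq> 0 \<and> coprime P Q \<and> (\<forall>z. R z = poly P z / poly Q z))"

definition is_numerical_cosine :: "nat \<Rightarrow> (complex \<Rightarrow> complex) \<Rightarrow> bool" where
  "is_numerical_cosine p R \<longleftrightarrow>
    rational_function R \<and>
    (\<exists>\<delta>>0. \<forall>h>0. \<forall>\<omega> k. norm (\<omega> * complex_of_real h) < \<delta> \<longrightarrow>
       ((\<exists>u. discrete_wave p h \<omega> k u) \<longleftrightarrow>
        cos (k * complex_of_real h) = R (\<omega> * complex_of_real h)))"

(* For p >= 1 the description is proper: cos is onto the complex plane, so the equivalence
   determines R near 0, and a rational function is determined by its values near 0. *)
definition numerical_cosine :: "nat \<Rightarrow> complex \<Rightarrow> complex" where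
  "numerical_cosine p = (THE R. is_numerical_cosine p R)"

end

theory Submission imports Defs "HOL-Library.Landau_Symbols" begin

text \<open>Write \<open>z = \<omega> h\<close> and map every mesh element to the reference element \<open>[-1/2, 1/2]\<close>. The
pieces of a wave with multiplier \<open>l = exp (\<i> k h)\<close> are the multiples \<open>l^j q\<close> of one polynomial \<open>q\<close>. It
solves the local equations against bubbles, and its fluxes balance at a node
(\<open>local_wave_of_discrete_wave\<close>, \<open>discrete_wave_of_local_wave\<close>).

The local equations have an even and an odd solution, whose degrees are the even and the
odd one of \<open>p - 1\<close> and \<open>p\<close>. They are explicit, since \<open>q'' + z\<^sup>2 q\<close> only has to be orthogonal to the
bubbles, hence may be a multiple of the Gegenbauer polynomial
\<open>D^(d+2) (y\<^sup>2 - 1/4)^(d+1)\<close>, where \<open>d\<close> is the degree in question. Let \<open>S_e\<close> and \<open>S_o\<close> be the ratios of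
flux and nodal value of the even and of the odd solution. The symmetry of the form shows that a wave exists if and only if \<open>cos (k h) = (S_o + S_e) / (S_o - S_e)\<close>
(\<open>ex_discrete_wave_iff\<close>). Nodal values and fluxes are polynomials in \<open>z\<^sup>2\<close>, so the right-hand side is
rational, and it is the numerical cosine near the origin (\<open>numerical_cosine_eq\<close>).

The exact solutions \<open>cos (z y)\<close> and \<open>sin (z y)\<close> have the ratios \<open>- z tan (z/2)\<close> and \<open>z cot (z/2)\<close>, for
which the same expression gives \<open>cos z\<close>. Green's identity between the discrete and the exact solution
shows that the ratios differ by a multiple of the integral of the Gegenbauer polynomial against
the exact solution minus its linear interpolant. The Rodrigues formula turns this integral
into \<open>z^(d+2) \<integral> (y\<^sup>2 - 1/4)^(d+1) exp (\<i> z y)\<close> up to a unit factor (\<open>disc_harmonic_flux_identity\<close>).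
This gives the exact formula
\<open>R z - cos z = z^(2p+2) A z + z^(2p+4) B z\<close> in \<open>cos_error_expansion\<close>, where \<open>A\<close> comes from degree \<open>p - 1\<close>
and \<open>B\<close> from degree \<open>p\<close>, both are bounded near zero, and \<open>A\<close> differs from its limit at zero by \<open>O(z\<^sup>2)\<close>. That limit is
the integral of \<open>(1/4 - y\<^sup>2)^p\<close>, which is \<open>(p!)\<^sup>2 / (2p+1)!\<close>, divided by \<open>2 (2p)!\<close>.\<close>

section \<open>Integrals of polynomials over the reference element\<close>

lemma poly_has_vector_derivative:
  "((\<lambda>x::real. poly p (complex_of_real x)) has_vector_derivative
     poly (pderiv p) (complex_of_real x)) (at x within S)"
  by (rule has_vector_derivative_real_field) (rule poly_DERIV)

lemma continuous_on_poly_of_real: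
  "continuous_on S (\<lambda>x::real. poly p (complex_of_real x))"
  by (intro continuous_intros)

lemma integral_by_parts_complex:
  fixes f g :: "real \<Rightarrow> complex"
  assumes "a \<le> b"
    and f: "\<And>x. (f has_vector_derivative f' x) (at x)"
    and g: "\<And>x. (g has_vector_derivative g' x) (at x)"
    and cont: "continuous_on {a..b} f'" "continuous_on {a..b} g'"
  shows "integral {a..b} (\<lambda>x. f' x * g x) =
    f b * g b - f a * g a - integral {a..b} (\<lambda>x. f x * g' x)"
proof -
  have cf: "continuous_on {a..b} f" "continuous_on {a..b} g"
    by (rule continuous_at_imp_continuous_on, rule ballI,
        rule has_vector_derivative_continuous, rule f g)+
  have "((\<lambda>x. f x * g' x + f' x * g x) has_integral f b * g b - f a * g a) {a..b}"
    using \<open>a \<le> b\<close>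
    by (rule fundamental_theorem_of_calculus[where f = "\<lambda>x. f x * g x"])
      (rule has_vector_derivative_mult has_vector_derivative_at_within[OF f]
        has_vector_derivative_at_within[OF g])+
  then have "integral {a..b} (\<lambda>x. f x * g' x + f' x * g x) = f b * g b - f a * g a"
    by (rule integral_unique)
  moreover have "(\<lambda>x. f x * g' x) integrable_on {a..b}" "(\<lambda>x. f' x * g x) integrable_on {a..b}"
    by (intro integrable_continuous_real continuous_on_mult cf cont)+
  ultimately show ?thesis
    by (simp add: integral_add algebra_simps)
qed

text \<open>The integral over the reference element \<open>[-1/2, 1/2]\<close>. It is centred at the origin so that
reflection splits all local problems into an even and an odd one.\<close>

definition ref_int :: "complex poly \<Rightarrow> complex" where
  "ref_int p = integral {-(1/2)..1/2} (\<lambda>y::real. poly p (complex_of_real y))"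

lemma poly_integrable [simp]:
  "(\<lambda>y::real. poly p (complex_of_real y)) integrable_on {a..b}"
  by (intro integrable_continuous_real continuous_on_poly_of_real)

lemma ref_int_add: "ref_int (p + q) = ref_int p + ref_int q"
  by (simp add: ref_int_def integral_add)

lemma ref_int_diff: "ref_int (p - q) = ref_int p - ref_int q"
  by (simp add: ref_int_def integral_diff)

lemma ref_int_smult: "ref_int (smult c p) = c * ref_int p"
  by (simp add: ref_int_def)

lemma ref_int_0 [simp]: "ref_int 0 = 0"
  by (simp add: ref_int_def)

lemma ref_int_pderiv: "ref_int (pderiv p) = poly p (1/2) - poly p (-(1/2))"
proof -
  have "((\<lambda>y. poly (pderiv p) (complex_of_real y)) has_integral
      poly p (of_real (1/2)) - poly p (of_real (-(1/2)))) {-(1/2)..1/2}"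
    by (rule fundamental_theorem_of_calculus) (auto intro: poly_has_vector_derivative)
  then show ?thesis by (simp add: ref_int_def integral_unique)
qed

lemma ref_int_by_parts:
  "ref_int (pderiv p * q) = poly (p * q) (1/2) - poly (p * q) (-(1/2)) - ref_int (p * pderiv q)"
  using ref_int_pderiv[of "p * q"] by (simp add: pderiv_mult ref_int_add algebra_simps)

lemma ref_int_reflect:
  "ref_int (pcompose p [:0, -1:]) = ref_int p"
proof -
  have "integral {-(1/2)..1/2} (\<lambda>y::real. poly p (complex_of_real (- y))) =
      integral {-(1/2)..1/2} (\<lambda>y::real. poly p (complex_of_real y))"
    using Henstock_Kurzweil_Integration.integral_reflect_real[of "1/2" "-(1/2)" "\<lambda>y. poly p (complex_of_real y)"] by simp
  then show ?thesis by (simp add: ref_int_def poly_pcompose)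
qed

section \<open>The bilinear form on the reference element\<close>

text \<open>The form \<open>\<integral> q' v' - Z \<integral> q v\<close> of one element after scaling it to length one; \<open>Z\<close> stands for the square
of \<open>\<omega> h\<close>. It is bilinear: the complex conjugate of the test function is taken beforehand.\<close>

definition element_form :: "complex \<Rightarrow> complex poly \<Rightarrow> complex poly \<Rightarrow> complex" where
  "element_form Z q v = ref_int (pderiv q * pderiv v) - Z * ref_int (q * v)"

lemma element_form_commute: "element_form Z q v = element_form Z v q"
  by (simp add: element_form_def mult.commute)

lemma element_form_add_right: "element_form Z q (v + w) = element_form Z q v + element_form Z q w"
  by (simp add: element_form_def pderiv_add algebra_simps ref_int_add)

lemma element_form_smult_right: "element_form Z q (smult c v) = c * element_form Z q v"
  by (simp add: element_form_def pderiv_smult algebra_simps ref_int_smult)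

lemma element_form_add_left: "element_form Z (v + w) q = element_form Z v q + element_form Z w q"
  by (simp add: element_form_def pderiv_add algebra_simps ref_int_add)

lemma element_form_smult_left: "element_form Z (smult c v) q = c * element_form Z v q"
  by (simp add: element_form_def pderiv_smult algebra_simps ref_int_smult)

lemma element_form_0_right [simp]: "element_form Z q 0 = 0"
  by (simp add: element_form_def)

text \<open>Integration by parts moves all derivatives onto \<open>q\<close>.\<close>

lemma element_form_strong:
  "element_form Z q v = poly (pderiv q * v) (1/2) - poly (pderiv q * v) (-(1/2))
     - ref_int ((pderiv (pderiv q) + smult Z q) * v)"
  using ref_int_by_parts[of "pderiv q" v]
  by (simp add: element_form_def algebra_simps ref_int_add ref_int_smult)

text \<open>The linear nodal basis functions of the left and of the right end of the element.\<close>

abbreviation left_hat :: "complex poly" where "left_hat \<equiv> [:1/2, -1:]"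
abbreviation right_hat :: "complex poly" where "right_hat \<equiv> [:1/2, 1:]"

text \<open>Bubbles: polynomials of degree at most \<open>p\<close> that vanish at both ends of the element.\<close>

definition bubble :: "nat \<Rightarrow> complex poly \<Rightarrow> bool" where
  "bubble p b \<longleftrightarrow> degree b \<le> p \<and> poly b (-(1/2)) = 0 \<and> poly b (1/2) = 0"

text \<open>If \<open>q\<close> satisfies the local equation against all bubbles, then \<open>v\<close> enters the form only through its two
nodal values. The values at the two hats are the discrete fluxes of \<open>q\<close> out of the element.\<close>

lemma element_form_of_nodal_values:
  assumes orth: "\<And>b. bubble p b \<Longrightarrow> element_form Z q b = 0"
    and "degree v \<le> p" "1 \<le> p"
  shows "element_form Z q v = poly v (-(1/2)) * element_form Z q left_hat + poly v (1/2) * element_form Z q right_hat"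
proof -
  define b where
    "b = v - (smult (poly v (-(1/2))) left_hat + smult (poly v (1/2)) right_hat)"
  have "bubble p b"
    using assms(2,3) by (auto simp: bubble_def b_def field_simps intro!: degree_diff_le degree_add_le)
  then have "element_form Z q b = 0" by (rule orth)
  moreover have "v = b + (smult (poly v (-(1/2))) left_hat + smult (poly v (1/2)) right_hat)"
    by (simp add: b_def)
  then have "element_form Z q v = element_form Z q b + (poly v (-(1/2)) * element_form Z q left_hat
      + poly v (1/2) * element_form Z q right_hat)"
    by (metis element_form_add_right element_form_smult_right)
  ultimately show ?thesis by simp
qed

section \<open>A Poincare inequality for bubbles\<close>

text \<open>The squared norm of a polynomial in the complex \<open>L\<^sup>2\<close> space of the reference element.\<close>

definition norm_sq_int :: "complex poly \<Rightarrow> real" where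
  "norm_sq_int p = integral {-(1/2)..1/2} (\<lambda>y::real. (norm (poly p (complex_of_real y)))\<^sup>2)"

lemma continuous_on_norm_square:
  "continuous_on S (\<lambda>y::real. (norm (poly p (complex_of_real y)))\<^sup>2)"
  by (intro continuous_intros)

lemma norm_square_integrable:
  "(\<lambda>y::real. (norm (poly p (complex_of_real y)))\<^sup>2) integrable_on {a..b}"
  by (rule integrable_continuous_real continuous_on_norm_square)+

lemma norm_sq_int_nonneg: "0 \<le> norm_sq_int p"
  unfolding norm_sq_int_def by (rule integral_nonneg[OF norm_square_integrable]) simp

lemma ref_int_norm_square: "ref_int (p * map_poly cnj p) = of_real (norm_sq_int p)"
proof -
  from has_integral_of_real[OF integrable_integral[OF norm_square_integrable[of p "-(1/2)" "1/2"]], where 'b = complex]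
  have "((\<lambda>y::real. poly (p * map_poly cnj p) (complex_of_real y)) has_integral
     of_real (norm_sq_int p)) {-(1/2)..1/2}"
    by (simp add: complex_norm_square[symmetric] norm_sq_int_def)
  then show ?thesis by (simp add: ref_int_def integral_unique)
qed

lemma pderiv_map_poly_cnj: "pderiv (map_poly cnj p) = map_poly cnj (pderiv p)"
  by (rule poly_eqI) (simp add: coeff_pderiv coeff_map_poly)

lemma degree_map_poly_cnj [simp]: "degree (map_poly cnj p) = degree p"
  by (rule degree_map_poly) simp

text \<open>The inequality comes from expanding the nonnegative integral of \<open>|q' + y q|\<^sup>2\<close>: the mixed terms form
\<open>y (|q|\<^sup>2)'\<close>, which integrates by parts to \<open>- |q|\<^sup>2\<close>, and \<open>y\<^sup>2 \<le> 1/4\<close> on the element.\<close>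

lemma poincare_bubble:
  assumes "poly q (-(1/2)) = 0" "poly q (1/2) = 0"
  shows "3/4 * norm_sq_int q \<le> norm_sq_int (pderiv q)"
proof -
  define Y :: "complex poly" where "Y = [:0, 1:]"
  define c where "c = map_poly cnj q"
  have c0: "poly c (-(1/2)) = 0" "poly c (1/2) = 0"
    using assms(1,2) by (simp_all add: c_def)
  have Yc: "map_poly cnj (pderiv q + Y * q) = pderiv c + Y * c"
  proof -
    have "poly (map_poly cnj (pderiv q + Y * q)) x = poly (pderiv c + Y * c) x" for x
      by (simp add: c_def Y_def pderiv_map_poly_cnj)
    then show ?thesis by (intro poly_eq_poly_eq_iff[THEN iffD1] ext)
  qed
  have dY: "pderiv Y = 1" by (simp add: Y_def pderiv_pCons)
  have "ref_int ((pderiv q + Y * q) * (pderiv c + Y * c))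
      = ref_int (pderiv q * pderiv c) + ref_int (pderiv (Y * (q * c)))
        - ref_int (q * c) + ref_int (Y * Y * (q * c))"
  proof -
    have "(pderiv q + Y * q) * (pderiv c + Y * c)
      = pderiv q * pderiv c + pderiv (Y * (q * c)) - q * c + Y * Y * (q * c)"
      by (simp add: pderiv_mult dY algebra_simps)
    then show ?thesis by (simp only: ref_int_add ref_int_diff)
  qed
  also have "ref_int (pderiv (Y * (q * c))) = 0"
    using assms(1,2) by (simp add: ref_int_pderiv)
  finally have 1: "ref_int ((pderiv q + Y * q) * (pderiv c + Y * c))
      = ref_int (pderiv q * pderiv c) - ref_int (q * c) + ref_int (Y * Y * (q * c))" by simp
  have 2: "ref_int ((pderiv q + Y * q) * (pderiv c + Y * c)) = of_real (norm_sq_int (pderiv q + Y * q))"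
    by (simp only: Yc[symmetric] ref_int_norm_square)
  have 3: "ref_int (pderiv q * pderiv c) = of_real (norm_sq_int (pderiv q))"
    by (simp only: c_def pderiv_map_poly_cnj ref_int_norm_square)
  have 4: "ref_int (q * c) = of_real (norm_sq_int q)"
    by (simp only: c_def ref_int_norm_square)
  have 5: "ref_int (Y * Y * (q * c)) = of_real (norm_sq_int (Y * q))"
  proof -
    have "map_poly cnj (Y * q) = Y * c"
      by (intro poly_eq_poly_eq_iff[THEN iffD1] ext) (simp add: c_def Y_def)
    then have "Y * Y * (q * c) = (Y * q) * map_poly cnj (Y * q)"
      by (simp add: algebra_simps)
    then show ?thesis by (simp only: ref_int_norm_square)
  qed
  from 1 have "complex_of_real (norm_sq_int (pderiv q + Y * q)) =
     of_real (norm_sq_int (pderiv q) - norm_sq_int q + norm_sq_int (Y * q))"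
    by (simp only: 2 3 4 5 of_real_add of_real_diff)
  then have "norm_sq_int (pderiv q + Y * q) = norm_sq_int (pderiv q) - norm_sq_int q + norm_sq_int (Y * q)"
    by (simp only: of_real_eq_iff)
  moreover have "0 \<le> norm_sq_int (pderiv q + Y * q)"
    by (rule norm_sq_int_nonneg)
  moreover have "norm_sq_int (Y * q) \<le> 1/4 * norm_sq_int q"
  proof -
    have "norm_sq_int (Y * q) \<le> integral {-(1/2)..1/2} (\<lambda>y::real. 1/4 * (norm (poly q (complex_of_real y)))\<^sup>2)"
      unfolding norm_sq_int_def
    proof (rule integral_le[OF norm_square_integrable])
      show "(\<lambda>y::real. 1/4 * (norm (poly q (complex_of_real y)))\<^sup>2) integrable_on {-(1/2)..1/2}"
        by (intro integrable_continuous_real continuous_on_mult continuous_on_const continuous_on_norm_square)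
    next
      fix y :: real assume "y \<in> {-(1/2)..1/2}"
      then have "y\<^sup>2 \<le> (1/2)\<^sup>2" by (intro abs_le_square_iff[THEN iffD1]) auto
      then have "y\<^sup>2 * (norm (poly q (complex_of_real y)))\<^sup>2 \<le> 1/4 * (norm (poly q (complex_of_real y)))\<^sup>2"
        by (intro mult_right_mono) (auto simp: power2_eq_square)
      then show "(norm (poly (Y * q) (complex_of_real y)))\<^sup>2 \<le> 1/4 * (norm (poly q (complex_of_real y)))\<^sup>2"
        by (simp add: Y_def norm_mult power_mult_distrib)
    qed
    then show ?thesis by (simp add: norm_sq_int_def)
  qed
  ultimately show ?thesis by linarith
qed

lemma poly_eq_0_on_reference:
  assumes "\<And>y::real. y \<in> {-(1/2)..1/2} \<Longrightarrow> poly q (complex_of_real y) = 0"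
  shows "q = 0"
proof (rule ccontr)
  assume "q \<noteq> 0"
  then have "finite {x. poly q x = 0}" by (rule poly_roots_finite)
  moreover have "complex_of_real ` {-(1/2)..1/2} \<subseteq> {x. poly q x = 0}" using assms by auto
  ultimately have "finite (complex_of_real ` {-(1/2)..1/2})" by (rule finite_subset[rotated])
  then have "finite {-(1/2)..1/2::real}" by (rule finite_imageD) (simp add: inj_on_def)
  then show False by (simp add: infinite_Icc)
qed

text \<open>At small frequencies the local problem with zero nodal values has only the zero solution.\<close>

lemma bubble_harmonic_eq_0:
  assumes b: "bubble p q" and orth: "\<And>b. bubble p b \<Longrightarrow> element_form Z q b = 0"
    and Z: "norm Z < 3/4"
  shows "q = 0"
proof -
  have "bubble p (map_poly cnj q)" using b by (simp add: bubble_def)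
  then have "element_form Z q (map_poly cnj q) = 0" by (rule orth)
  then have "complex_of_real (norm_sq_int (pderiv q)) = Z * of_real (norm_sq_int q)"
    by (simp add: element_form_def pderiv_map_poly_cnj ref_int_norm_square)
  then have "\<bar>norm_sq_int (pderiv q)\<bar> = norm Z * \<bar>norm_sq_int q\<bar>" by (metis norm_mult norm_of_real)
  moreover have nonneg: "0 \<le> norm_sq_int r" for r
    by (rule norm_sq_int_nonneg)
  moreover have "3/4 * norm_sq_int q \<le> norm_sq_int (pderiv q)"
    using poincare_bubble[of q] b by (simp add: bubble_def)
  ultimately have "3/4 * norm_sq_int q \<le> norm Z * norm_sq_int q"
    by (metis abs_of_nonneg)
  then have "(3/4 - norm Z) * norm_sq_int q \<le> 0" by (simp add: left_diff_distrib)
  moreover have "0 < 3/4 - norm Z" using Z by simp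
  ultimately have "norm_sq_int q \<le> 0" by (metis mult_le_0_iff not_less)
  with norm_sq_int_nonneg[of q] have "norm_sq_int q = 0" by simp
  have "poly q (complex_of_real y) = 0" if "y \<in> {-(1/2)..1/2}" for y
  proof -
    have "((\<lambda>y::real. (norm (poly q (complex_of_real y)))\<^sup>2) has_integral 0) (cbox (-(1/2)) (1/2))"
      using integrable_integral[OF norm_square_integrable[of q "-(1/2)" "1/2"]] \<open>norm_sq_int q = 0\<close>
      by (simp add: norm_sq_int_def)
    from has_integral_0_cbox_imp_0[OF continuous_on_norm_square _ this, of y] that
    show ?thesis by simp
  qed
  then show ?thesis by (rule poly_eq_0_on_reference)
qed

section \<open>Gegenbauer polynomials\<close>

lemma higher_pderiv_root:
  fixes p :: "'a::idom poly"
  assumes "[:- a, 1:] ^ n dvd p" "k < n"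
  shows "poly ((pderiv ^^ k) p) a = 0"
  using assms
proof (induction k arbitrary: n p)
  case 0
  then have "[:- a, 1:] dvd p"
    by (metis dvd_power dvd_trans)
  then show ?case by (simp add: poly_eq_0_iff_dvd)
next
  case (Suc k)
  obtain m where n: "n = Suc m" using Suc.prems(2) by (cases n) auto
  obtain r where r: "p = [:- a, 1:] ^ n * r" using Suc.prems(1) by (rule dvdE)
  have "[:- a, 1:] ^ m dvd pderiv p"
  proof -
    have "pderiv p = [:- a, 1:] ^ m * ([:- a, 1:] * pderiv r + r * smult (of_nat (Suc m)) (pderiv [:- a, 1:]))"
      by (simp only: r n pderiv_mult pderiv_power_Suc) (simp add: algebra_simps)
    then show ?thesis by simp
  qed
  with Suc.IH[of m "pderiv p"] Suc.prems(2) n show ?case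
    by (simp add: funpow_swap1)
qed

text \<open>The weight \<open>(y\<^sup>2 - 1/4)^(d+1)\<close> of a Rodrigues formula; it vanishes to order \<open>d + 1\<close> at both ends.\<close>

definition bump :: "nat \<Rightarrow> complex poly" where
  "bump d = [:-1/4, 0, 1:] ^ (d + 1)"

text \<open>A multiple of the derivative of the Legendre polynomial of degree \<open>d + 1\<close>, that is, of the Gegenbauer
polynomial of degree \<open>d\<close> and index \<open>3/2\<close>, transplanted to the reference element. It is orthogonal to all bubbles of degree at most \<open>d + 1\<close>.\<close>

definition gegenbauer :: "nat \<Rightarrow> complex poly" where
  "gegenbauer d = (pderiv ^^ (d + 2)) (bump d)"

lemma bump_boundary:
  assumes "k \<le> d"
  shows "poly ((pderiv ^^ k) (bump d)) (1/2) = 0" "poly ((pderiv ^^ k) (bump d)) (-(1/2)) = 0"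
proof -
  have "bump d = ([:-(1/2), 1:] * [:-(-(1/2)), 1:]) ^ (d + 1)"
    by (simp add: bump_def)
  then have *: "bump d = [:-(1/2), 1:] ^ (d + 1) * [:-(-(1/2)), 1:] ^ (d + 1)"
    by (simp only: power_mult_distrib)
  have "[:-(1/2), 1:] ^ (d + 1) dvd bump d" "[:-(-(1/2)), 1:] ^ (d + 1) dvd bump d"
    unfolding * by (rule dvd_triv_left dvd_triv_right)+
  with assms show "poly ((pderiv ^^ k) (bump d)) (1/2) = 0"
    "poly ((pderiv ^^ k) (bump d)) (-(1/2)) = 0"
    using higher_pderiv_root[of "1/2" "d + 1" "bump d" k]
      higher_pderiv_root[of "-(1/2)" "d + 1" "bump d" k] by simp_all
qed

lemma iterated_by_parts_bump:
  fixes f :: "nat \<Rightarrow> real \<Rightarrow> complex"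
  assumes f: "\<And>k y. (f k has_vector_derivative f (Suc k) y) (at y)" and "n \<le> d + 1"
  shows "integral {-(1/2)..1/2} (\<lambda>y. poly ((pderiv ^^ n) (bump d)) (of_real y) * f k y) =
    (-1) ^ n * integral {-(1/2)..1/2} (\<lambda>y. poly (bump d) (of_real y) * f (k + n) y)"
  using assms(2)
proof (induction n arbitrary: k)
  case 0
  show ?case by simp
next
  case (Suc n)
  have cont: "continuous_on {-(1/2)..1/2} (f (Suc k))"
    by (rule continuous_at_imp_continuous_on, rule ballI, rule has_vector_derivative_continuous, rule f)
  have "integral {-(1/2)..1/2} (\<lambda>y. poly ((pderiv ^^ Suc n) (bump d)) (of_real y) * f k y) =
      - integral {-(1/2)..1/2} (\<lambda>y. poly ((pderiv ^^ n) (bump d)) (of_real y) * f (Suc k) y)"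
    using integral_by_parts_complex[of "-(1/2)" "1/2" "\<lambda>y. poly ((pderiv ^^ n) (bump d)) (of_real y)"
        "\<lambda>y. poly ((pderiv ^^ Suc n) (bump d)) (of_real y)" "f k" "f (Suc k)"]
      bump_boundary[of n d] Suc.prems
    by (simp add: poly_has_vector_derivative f cont continuous_on_poly_of_real)
  also have "\<dots> = (-1) ^ Suc n * integral {-(1/2)..1/2} (\<lambda>y. poly (bump d) (of_real y) * f (k + Suc n) y)"
    using Suc by simp
  finally show ?case .
qed

text \<open>The functions \<open>f k\<close> are the successive derivatives of \<open>f 0\<close>. The boundary terms vanish: the first one
because \<open>f 0\<close> is zero at the ends, the others because the weight is. The lemma is used for polynomial
\<open>f 0\<close> (orthogonality to bubbles) and for an exponential minus its linear interpolant.\<close>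

lemma gegenbauer_rodrigues:
  fixes f :: "nat \<Rightarrow> real \<Rightarrow> complex"
  assumes f: "\<And>k y. (f k has_vector_derivative f (Suc k) y) (at y)"
    and zero: "f 0 (-(1/2)) = 0" "f 0 (1/2) = 0"
  shows "integral {-(1/2)..1/2} (\<lambda>y. poly (gegenbauer d) (of_real y) * f 0 y) =
    (-1) ^ d * integral {-(1/2)..1/2} (\<lambda>y. poly (bump d) (of_real y) * f (d + 2) y)"
proof -
  have cont: "continuous_on {-(1/2)..1/2} (f (Suc 0))"
    by (rule continuous_at_imp_continuous_on, rule ballI, rule has_vector_derivative_continuous, rule f)
  have g: "gegenbauer d = pderiv ((pderiv ^^ (d + 1)) (bump d))"
    by (simp add: gegenbauer_def)
  have "integral {-(1/2)..1/2} (\<lambda>y. poly (gegenbauer d) (of_real y) * f 0 y) =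
      - integral {-(1/2)..1/2} (\<lambda>y. poly ((pderiv ^^ (d + 1)) (bump d)) (of_real y) * f (Suc 0) y)"
    using integral_by_parts_complex[of "-(1/2)" "1/2" "\<lambda>y. poly ((pderiv ^^ (d + 1)) (bump d)) (of_real y)"
        "\<lambda>y. poly (gegenbauer d) (of_real y)" "f 0" "f (Suc 0)"] zero
    by (simp add: poly_has_vector_derivative f cont continuous_on_poly_of_real g del: funpow.simps)
  also have "\<dots> = (-1) ^ d * integral {-(1/2)..1/2} (\<lambda>y. poly (bump d) (of_real y) * f (d + 2) y)"
    by (subst iterated_by_parts_bump[where f = f, OF f]) simp_all
  finally show ?thesis .
qed

lemma degree_bump: "degree (bump d) = 2 * d + 2"
proof -
  have "degree [:-1/4, 0, 1 :: complex:] = 2" by simp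
  then show ?thesis by (simp only: bump_def degree_power_eq[of "[:-1/4, 0, 1:]"] pCons_eq_0_iff one_neq_zero simp_thms) simp
qed

lemma lead_coeff_bump: "coeff (bump d) (2 * d + 2) = 1"
proof -
  have "lead_coeff (bump d) = 1" by (simp only: bump_def lead_coeff_power) simp
  then show ?thesis by (simp only: degree_bump)
qed

lemma degree_gegenbauer: "degree (gegenbauer d) = d"
  by (simp only: gegenbauer_def degree_higher_pderiv degree_bump diff_add_inverse2)

lemma higher_pderiv_bump_top: "(pderiv ^^ (2 * d + 2)) (bump d) = [:fact (2 * d + 2):]"
proof -
  let ?P = "(pderiv ^^ (2 * d + 2)) (bump d)"
  have "degree ?P = 0" by (simp only: degree_higher_pderiv degree_bump)
  then have "?P = [:coeff ?P 0:]" by (metis degree_0_id)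
  also have "coeff ?P 0 = pochhammer 1 (2 * d + 2) * coeff (bump d) (2 * d + 2)"
    by (simp only: coeff_higher_pderiv of_nat_1 One_nat_def[symmetric] add_0)
  also have "\<dots> = fact (2 * d + 2)" by (simp only: lead_coeff_bump pochhammer_fact mult_1_right)
  finally show ?thesis .
qed

lemma higher_pderiv_eq_0:
  fixes p :: "'a::{comm_semiring_1,semiring_no_zero_divisors,semiring_char_0} poly"
  assumes "degree p < n"
  shows "(pderiv ^^ n) p = 0"
  by (rule poly_eqI) (use assms in \<open>simp add: coeff_higher_pderiv coeff_eq_0\<close>)

lemma gegenbauer_orthogonal_bubble:
  assumes "bubble (d + 1) b"
  shows "ref_int (gegenbauer d * b) = 0"
proof -
  have "(pderiv ^^ (d + 2)) b = 0"
    using assms by (intro higher_pderiv_eq_0) (simp add: bubble_def)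
  then show ?thesis
    using gegenbauer_rodrigues[of "\<lambda>k y. poly ((pderiv ^^ k) b) (of_real y)" d] assms
    by (simp add: ref_int_def bubble_def poly_has_vector_derivative)
qed

text \<open>Reflection of the reference element at its midpoint.\<close>

abbreviation reflect :: "complex poly \<Rightarrow> complex poly" where
  "reflect p \<equiv> pcompose p [:0, -1:]"

lemma pderiv_reflect: "pderiv (reflect p) = - reflect (pderiv p)"
  by (simp add: pderiv_pcompose pderiv_pCons)

lemma higher_pderiv_reflect:
  "(pderiv ^^ n) (reflect p) = smult ((-1) ^ n) (reflect ((pderiv ^^ n) p))"
  by (induction n) (simp_all add: pderiv_smult pderiv_reflect)

lemma reflect_bump: "reflect (bump d) = bump d"
proof -
  have "reflect ([:-1/4, 0, 1:] ^ n) = [:-1/4, 0, 1:] ^ n" for n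
    by (induction n) (simp_all only: power_Suc power_0 pcompose_mult, simp_all add: pcompose_pCons pcompose_1)
  then show ?thesis by (simp only: bump_def)
qed

lemma reflect_higher_pderiv_bump:
  "reflect ((pderiv ^^ n) (bump d)) = smult ((-1) ^ n) ((pderiv ^^ n) (bump d))"
proof -
  have "smult ((-1) ^ n) ((pderiv ^^ n) (bump d)) =
      smult ((-1) ^ n * (-1) ^ n) (reflect ((pderiv ^^ n) (bump d)))"
    using higher_pderiv_reflect[of n "bump d"] by (metis reflect_bump smult_smult)
  then show ?thesis by (simp flip: power_add mult_2)
qed

lemma reflect_gegenbauer: "reflect (gegenbauer d) = smult ((-1) ^ d) (gegenbauer d)"
  using reflect_higher_pderiv_bump[of "d + 2" d] by (simp add: gegenbauer_def)

lemma element_form_reflect: "element_form Z (reflect q) (reflect v) = element_form Z q v"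
  using ref_int_reflect[of "pderiv q * pderiv v"] ref_int_reflect[of "q * v"]
  by (simp add: element_form_def pderiv_reflect pcompose_mult)

section \<open>Discrete harmonic polynomials\<close>

text \<open>The polynomial \<open>\<Sum>k\<le>n. (-1)^k Z^(n-k) D^(2k) g\<close>, written as a Horner scheme. If the derivative of \<open>g\<close>
of order \<open>2 n + 2\<close> vanishes, it solves \<open>q'' + Z q = Z^(n+1) g\<close>. This normalization, instead of the
right-hand side \<open>g\<close>, keeps the coefficients polynomial in \<open>Z\<close> and, for \<open>n = degree g div 2\<close> and nonzero
\<open>g\<close>, the solution nonzero at \<open>Z = 0\<close>.\<close>

primrec particular :: "complex poly \<Rightarrow> complex \<Rightarrow> nat \<Rightarrow> complex poly" where
  "particular g Z 0 = g"
| "particular g Z (Suc n) =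
     smult Z (particular g Z n) + smult ((-1) ^ Suc n) ((pderiv ^^ (2 * n + 2)) g)"

lemma particular_ode:
  "pderiv (pderiv (particular g Z n)) + smult Z (particular g Z n) =
    smult (Z ^ (n + 1)) g + smult ((-1) ^ n) ((pderiv ^^ (2 * n + 2)) g)"
proof (induction n)
  case 0
  show ?case by (simp add: numeral_2_eq_2)
next
  case (Suc n)
  define D where "D = (pderiv ^^ (2 * n + 2)) g"
  define P where "P = particular g Z n"
  define s :: complex where "s = (-1) ^ Suc n"
  have s: "(-1) ^ n = - s" by (simp add: s_def)
  have D: "(pderiv ^^ (2 * Suc n + 2)) g = pderiv (pderiv D)" by (simp add: D_def)
  have "pderiv (pderiv (particular g Z (Suc n))) + smult Z (particular g Z (Suc n)) =
      smult Z (pderiv (pderiv P) + smult Z P) + smult s (pderiv (pderiv D) + smult Z D)"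
    unfolding particular.simps(2) P_def[symmetric] D_def[symmetric] s_def[symmetric]
    by (simp add: pderiv_add pderiv_smult smult_add_right mult.commute)
  also have "pderiv (pderiv P) + smult Z P = smult (Z ^ (n + 1)) g + smult (- s) D"
    unfolding P_def Suc.IH D_def s ..
  finally show ?case
    unfolding D s_def[symmetric] by (simp add: smult_add_right smult_diff_right mult.commute)
qed

lemma degree_particular: "degree (particular g Z n) \<le> degree g"
proof (induction n)
  case (Suc n)
  have "degree (smult ((-1) ^ Suc n) ((pderiv ^^ (2 * n + 2)) g)) \<le> degree g"
    by (rule order.trans[OF degree_smult_le]) (simp only: degree_higher_pderiv diff_le_self)
  moreover have "degree (smult Z (particular g Z n)) \<le> degree g"
    using Suc by (rule order.trans[OF degree_smult_le])
  ultimately show ?case by (simp only: particular.simps degree_add_le)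
qed simp

lemma reflect_particular:
  assumes "reflect g = smult s g"
  shows "reflect (particular g Z n) = smult s (particular g Z n)"
proof (induction n)
  case 0
  show ?case by (simp add: assms)
next
  case (Suc n)
  define D where "D = (pderiv ^^ (2 * n + 2)) g"
  have "reflect D = smult s D"
    using higher_pderiv_reflect[of "2 * n + 2" g] by (simp add: assms higher_pderiv_smult D_def del: funpow.simps)
  with Suc show ?case
    unfolding particular.simps D_def[symmetric]
    by (simp only: pcompose_add pcompose_smult smult_add_right smult_smult mult.commute)
qed

lemma particular_at_0:
  "particular g 0 n = smult ((-1) ^ n) ((pderiv ^^ (2 * n)) g)"
  by (cases n) simp_all

text \<open>Every linear functional of the solution is a polynomial in \<open>Z\<close>; this makes the numerical cosine rational.\<close>

lemma particular_linear_functional: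
  fixes l :: "complex poly \<Rightarrow> complex"
  assumes add: "\<And>p q. l (p + q) = l p + l q" and smult: "\<And>c p. l (smult c p) = c * l p"
  shows "\<exists>P. \<forall>Z. l (particular g Z n) = poly P Z"
proof (induction n)
  case 0
  show ?case by (intro exI[of _ "[:l g:]"]) simp
next
  case (Suc n)
  then obtain P where "\<And>Z. l (particular g Z n) = poly P Z" by blast
  then have "\<forall>Z. l (particular g Z (Suc n)) =
      poly (pCons (l (smult ((-1) ^ Suc n) ((pderiv ^^ (2 * n + 2)) g))) P) Z"
    by (simp only: particular.simps add smult poly_pCons) simp
  then show ?case by blast
qed

text \<open>The discrete harmonic polynomial of degree \<open>d\<close>: a solution of the local finite element equations on one
element for \<open>p = d\<close> and \<open>p = d + 1\<close>. It has the parity of \<open>d\<close>.\<close>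

definition disc_harmonic :: "nat \<Rightarrow> complex \<Rightarrow> complex poly" where
  "disc_harmonic d Z = particular (gegenbauer d) Z (d div 2)"

text \<open>Value of the discrete harmonic polynomial at the right end of the element. At the left end the value
is the same up to the sign \<open>(-1)^d\<close>.\<close>

definition node :: "nat \<Rightarrow> complex \<Rightarrow> complex" where
  "node d Z = poly (disc_harmonic d Z) (1/2)"

text \<open>Discrete flux of the discrete harmonic polynomial through the right end of the element.\<close>

definition flux :: "nat \<Rightarrow> complex \<Rightarrow> complex" where
  "flux d Z = element_form Z (disc_harmonic d Z) right_hat"

lemma degree_disc_harmonic: "degree (disc_harmonic d Z) \<le> d"
  by (metis degree_gegenbauer degree_particular disc_harmonic_def)

lemma disc_harmonic_ode:
  "pderiv (pderiv (disc_harmonic d Z)) + smult Z (disc_harmonic d Z) = smult (Z ^ (d div 2 + 1)) (gegenbauer d)"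
proof -
  have "d < 2 * (d div 2) + 2" by presburger
  then have "(pderiv ^^ (2 * (d div 2) + 2)) (gegenbauer d) = 0"
    by (intro higher_pderiv_eq_0) (simp only: degree_gegenbauer)
  then show ?thesis by (simp only: disc_harmonic_def particular_ode) simp
qed

lemma reflect_disc_harmonic: "reflect (disc_harmonic d Z) = smult ((-1) ^ d) (disc_harmonic d Z)"
  unfolding disc_harmonic_def by (rule reflect_particular[OF reflect_gegenbauer])

lemma disc_harmonic_left_node: "poly (disc_harmonic d Z) (-(1/2)) = (-1) ^ d * node d Z"
  using arg_cong[OF reflect_disc_harmonic, of "\<lambda>p. poly p (1/2)" d Z]
  by (simp add: poly_pcompose node_def)

lemma disc_harmonic_left_flux: "element_form Z (disc_harmonic d Z) left_hat = (-1) ^ d * flux d Z"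
proof -
  have "reflect right_hat = left_hat" by (simp add: pcompose_pCons)
  then have "flux d Z = element_form Z (reflect (disc_harmonic d Z)) left_hat"
    by (metis element_form_reflect flux_def)
  then have "(-1) ^ d * flux d Z = (-1) ^ d * ((-1) ^ d * element_form Z (disc_harmonic d Z) left_hat)"
    by (simp only: reflect_disc_harmonic element_form_smult_left)
  then show ?thesis by (simp flip: mult.assoc power_add)
qed

lemma disc_harmonic_orthogonal_bubble:
  assumes "bubble p b" "p \<le> d + 1"
  shows "element_form Z (disc_harmonic d Z) b = 0"
proof -
  have b: "bubble (d + 1) b" using assms by (simp add: bubble_def)
  then show ?thesis
    unfolding element_form_strong disc_harmonic_ode
    by (simp add: ref_int_smult gegenbauer_orthogonal_bubble) (simp add: bubble_def)
qed

section \<open>Comparison with the exact solution\<close>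

text \<open>The Fourier transform of the weight at \<open>z\<close>, up to normalization a Bessel function divided by a power
of \<open>z\<close>.\<close>

definition moment :: "nat \<Rightarrow> complex \<Rightarrow> complex" where
  "moment d z = integral {-(1/2)..1/2}
     (\<lambda>y::real. poly (bump d) (of_real y) * exp (\<i> * z * of_real y))"

lemma exp_has_vector_derivative:
  "((\<lambda>y::real. exp (c * of_real y)) has_vector_derivative c * exp (c * of_real y)) (at y within S)"
  for c :: complex
  by (rule has_vector_derivative_real_field[where f = "\<lambda>w. exp (c * w)"])
    (auto intro!: derivative_eq_intros)

text \<open>Green's identity between the discrete harmonic polynomial and the exact solution \<open>exp (\<i> z y)\<close>. Without
the last term it would say that the discrete flux is the exact one. The last term, the
integral of the Gegenbauer polynomial against the exponential minus its linear interpolant, is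
small of order \<open>z^(d+2)\<close> by the Rodrigues formula, besides the factor from the normalization.\<close>

lemma disc_harmonic_flux_identity:
  "exp (\<i> * z / 2) * flux d (z\<^sup>2) + exp (- (\<i> * z / 2)) * ((-1) ^ d * flux d (z\<^sup>2)) =
    \<i> * z * (node d (z\<^sup>2) * exp (\<i> * z / 2) - (-1) ^ d * node d (z\<^sup>2) * exp (- (\<i> * z / 2)))
    + (z\<^sup>2) ^ (d div 2 + 1) * ((-1) ^ d * ((\<i> * z) ^ (d + 2) * moment d z))"
proof -
  define q where "q = disc_harmonic d (z\<^sup>2)"
  \<comment> \<open>The linear interpolant of the exponential at the two ends.\<close>
  define L where "L = smult (exp (\<i> * z / 2)) right_hat + smult (exp (- (\<i> * z / 2))) left_hat"
  define e where "e = (\<lambda>y::real. exp (\<i> * z * of_real y))"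
  define f where "f = (\<lambda>k (y::real). (\<i> * z) ^ k * e y - poly ((pderiv ^^ k) L) (of_real y))"
  define g where "g = smult ((z\<^sup>2) ^ (d div 2 + 1)) (gegenbauer d)"
  have ode: "pderiv (pderiv q) + smult (z\<^sup>2) q = g"
    unfolding q_def g_def by (rule disc_harmonic_ode)
  have ce: "continuous_on S e" for S unfolding e_def by (intro continuous_intros)
  have L: "poly L (1/2) = exp (\<i> * z / 2)" "poly L (-(1/2)) = exp (- (\<i> * z / 2))"
    by (simp_all add: L_def field_simps)
  have "degree L \<le> 1"
    unfolding L_def by (intro degree_add_le order.trans[OF degree_smult_le]) simp_all
  then have L0: "(pderiv ^^ (d + 2)) L = 0" by (intro higher_pderiv_eq_0) simp
  have "exp (\<i> * z / 2) * flux d (z\<^sup>2) + exp (- (\<i> * z / 2)) * ((-1) ^ d * flux d (z\<^sup>2))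
      = element_form (z\<^sup>2) q L"
    by (simp only: L_def element_form_add_right element_form_smult_right disc_harmonic_left_flux q_def flux_def)
  also have "\<dots> = poly (pderiv q) (1/2) * exp (\<i> * z / 2)
      - poly (pderiv q) (-(1/2)) * exp (- (\<i> * z / 2)) - ref_int (g * L)"
    unfolding element_form_strong ode by (simp add: L)
  also have "ref_int (g * L) = integral {-(1/2)..1/2} (\<lambda>y. poly g (of_real y) * e y)
      - integral {-(1/2)..1/2} (\<lambda>y. poly g (of_real y) * f 0 y)"
  proof -
    have "(\<lambda>y. poly g (of_real y) * e y) integrable_on {-(1/2)..1/2}"
      "(\<lambda>y. poly g (of_real y) * f 0 y) integrable_on {-(1/2)..1/2}"
      unfolding f_def
      by (intro integrable_continuous_real continuous_intros ce)+
    then show ?thesis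
      by (simp add: ref_int_def f_def integral_diff[symmetric] algebra_simps)
  qed
  also have "integral {-(1/2)..1/2} (\<lambda>y. poly g (of_real y) * f 0 y) =
      (z\<^sup>2) ^ (d div 2 + 1) * ((-1) ^ d * ((\<i> * z) ^ (d + 2) * moment d z))"
  proof -
    have der: "(f k has_vector_derivative f (Suc k) y) (at y)" for k y
      unfolding f_def e_def
      by (rule has_vector_derivative_eq_rhs, rule has_vector_derivative_diff,
          rule has_vector_derivative_mult_right, rule exp_has_vector_derivative,
          rule poly_has_vector_derivative) (simp add: mult_ac)
    have "integral {-(1/2)..1/2} (\<lambda>y. poly (gegenbauer d) (of_real y) * f 0 y) =
        (-1) ^ d * integral {-(1/2)..1/2} (\<lambda>y. poly (bump d) (of_real y) * f (d + 2) y)"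
      by (rule gegenbauer_rodrigues[where f = f, OF der]) (simp_all add: f_def e_def L)
    also have "(\<lambda>y. poly (bump d) (of_real y) * f (d + 2) y) =
        (\<lambda>y. (\<i> * z) ^ (d + 2) * (poly (bump d) (of_real y) * exp (\<i> * z * of_real y)))"
      by (simp only: f_def L0 e_def) (simp add: mult_ac)
    finally show ?thesis
      by (simp add: g_def moment_def mult.assoc)
  qed
  also have "integral {-(1/2)..1/2} (\<lambda>y. poly g (of_real y) * e y) =
      (poly (pderiv q) (1/2) - \<i> * z * poly q (1/2)) * exp (\<i> * z / 2)
      - (poly (pderiv q) (-(1/2)) - \<i> * z * poly q (-(1/2))) * exp (- (\<i> * z / 2))"
  proof -
    \<comment> \<open>The product of \<open>r\<close> and \<open>e\<close> is an antiderivative of \<open>g e\<close>, as \<open>q'' + z\<^sup>2 q = g\<close>.\<close>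
    define r where "r = pderiv q - smult (\<i> * z) q"
    have eq: "poly r (of_real y) * (\<i> * z * e y) + poly (pderiv r) (of_real y) * e y
        = poly g (of_real y) * e y" for y
      unfolding ode[symmetric] r_def
      by (simp add: pderiv_diff pderiv_smult algebra_simps power2_eq_square)
    have "((\<lambda>y. poly r (of_real y) * (\<i> * z * e y) + poly (pderiv r) (of_real y) * e y)
        has_integral poly r (of_real (1/2)) * e (1/2) - poly r (of_real (-(1/2))) * e (-(1/2))) {-(1/2)..1/2}"
      by (rule fundamental_theorem_of_calculus[where f = "\<lambda>y. poly r (of_real y) * e y"])
        (simp, unfold e_def, rule has_vector_derivative_mult,
          rule poly_has_vector_derivative, rule exp_has_vector_derivative)
    then show ?thesis
      unfolding eq by (simp add: integral_unique r_def e_def)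
  qed
  finally show ?thesis
    by (simp add: q_def node_def[symmetric] disc_harmonic_left_node algebra_simps)
qed

lemma exp_half_sum_diff:
  "exp (\<i> * z / 2) + exp (- (\<i> * z / 2)) = 2 * cos (z / 2)"
  "exp (\<i> * z / 2) - exp (- (\<i> * z / 2)) = 2 * \<i> * sin (z / 2)"
  for z :: complex
  by (simp_all add: cos_exp_eq sin_exp_eq field_simps)

text \<open>For even degree the ratio of flux and nodal value approximates the exact value \<open>- z tan (z/2)\<close>.\<close>

lemma even_flux_identity:
  fixes z :: complex and m :: nat
  defines "d \<equiv> 2 * m"
  shows "flux d (z\<^sup>2) * cos (z / 2) = - z * node d (z\<^sup>2) * sin (z / 2)
    - (-1) ^ m / 2 * z ^ (2 * d + 4) * moment d z"
proof -
  have "2 * (flux d (z\<^sup>2) * cos (z / 2)) = flux d (z\<^sup>2) * (exp (\<i> * z / 2) + exp (- (\<i> * z / 2)))"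
    by (simp only: exp_half_sum_diff) simp
  also have "\<dots> = \<i> * z * node d (z\<^sup>2) * (exp (\<i> * z / 2) - exp (- (\<i> * z / 2)))
      + (z\<^sup>2) ^ (m + 1) * ((\<i> * z) ^ (d + 2) * moment d z)"
    using disc_harmonic_flux_identity[of z d] by (simp add: d_def algebra_simps)
  also have "(\<i> * z) ^ (d + 2) = (-1) ^ (m + 1) * (z\<^sup>2) ^ (m + 1)"
  proof -
    have "d + 2 = 2 * (m + 1)" by (simp add: d_def)
    then have "(\<i> * z) ^ (d + 2) = (- (z\<^sup>2)) ^ (m + 1)"
      by (simp only: power_mult) (simp add: power_mult_distrib)
    then show ?thesis by (simp only: power_minus[of "z\<^sup>2"])
  qed
  also have "(z\<^sup>2) ^ (m + 1) * ((-1) ^ (m + 1) * (z\<^sup>2) ^ (m + 1) * moment d z)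
     = - ((-1) ^ m * z ^ (2 * d + 4) * moment d z)"
  proof -
    have "z ^ (2 * d + 4) = (z\<^sup>2) ^ (m + 1) * (z\<^sup>2) ^ (m + 1)"
    proof -
      have "2 * d + 4 = 2 * (m + 1) + 2 * (m + 1)" by (simp add: d_def)
      then show ?thesis by (simp only: power_add power_mult)
    qed
    then show ?thesis by simp
  qed
  finally show ?thesis
    by (simp only: exp_half_sum_diff) (simp add: field_simps)
qed

text \<open>For odd degree the ratio of flux and nodal value approximates the exact value \<open>z cot (z/2)\<close>.\<close>

lemma odd_flux_identity:
  fixes z :: complex and m :: nat
  defines "d \<equiv> 2 * m + 1"
  shows "flux d (z\<^sup>2) * sin (z / 2) = z * node d (z\<^sup>2) * cos (z / 2)
    + (-1) ^ m / 2 * z ^ (2 * d + 3) * moment d z"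
proof -
  have "2 * \<i> * (flux d (z\<^sup>2) * sin (z / 2)) = flux d (z\<^sup>2) * (exp (\<i> * z / 2) - exp (- (\<i> * z / 2)))"
    by (simp only: exp_half_sum_diff) simp
  also have "\<dots> = \<i> * z * node d (z\<^sup>2) * (exp (\<i> * z / 2) + exp (- (\<i> * z / 2)))
      - (z\<^sup>2) ^ (m + 1) * ((\<i> * z) ^ (d + 2) * moment d z)"
    using disc_harmonic_flux_identity[of z d] by (simp add: d_def algebra_simps)
  also have "(\<i> * z) ^ (d + 2) = (-1) ^ (m + 1) * \<i> * (z * (z\<^sup>2) ^ (m + 1))"
  proof -
    have "d + 2 = Suc (2 * (m + 1))" by (simp add: d_def)
    then have "(\<i> * z) ^ (d + 2) = \<i> * z * (- (z\<^sup>2)) ^ (m + 1)"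
      by (simp only: power_Suc power_mult) (simp add: power_mult_distrib)
    then show ?thesis by (simp only: power_minus[of "z\<^sup>2"]) simp
  qed
  also have "(z\<^sup>2) ^ (m + 1) * ((-1) ^ (m + 1) * \<i> * (z * (z\<^sup>2) ^ (m + 1)) * moment d z)
     = - (\<i> * (-1) ^ m * z ^ (2 * d + 3) * moment d z)"
  proof -
    have "z ^ (2 * d + 3) = z * ((z\<^sup>2) ^ (m + 1) * (z\<^sup>2) ^ (m + 1))"
    proof -
      have "2 * d + 3 = Suc (2 * (m + 1) + 2 * (m + 1))" by (simp add: d_def)
      then show ?thesis by (simp only: power_Suc power_add power_mult)
    qed
    then show ?thesis by simp
  qed
  finally have "\<i> * (2 * (flux d (z\<^sup>2) * sin (z / 2))) =
      \<i> * (2 * z * node d (z\<^sup>2) * cos (z / 2) + (-1) ^ m * z ^ (2 * d + 3) * moment d z)"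
    by (simp only: exp_half_sum_diff) (simp add: algebra_simps)
  then have "2 * (flux d (z\<^sup>2) * sin (z / 2)) =
      2 * z * node d (z\<^sup>2) * cos (z / 2) + (-1) ^ m * z ^ (2 * d + 3) * moment d z"
    by (rule mult_left_cancel[OF complex_i_not_zero, THEN iffD1])
  then show ?thesis by (simp add: field_simps)
qed

lemma even_values_at_0:
  "node (2 * m) 0 = (-1) ^ m * fact (4 * m + 2)" "flux (2 * m) 0 = 0"
proof -
  have "disc_harmonic (2 * m) 0 = smult ((-1) ^ m) [:fact (4 * m + 2):]"
  proof -
    have "2 * (2 * m) + 2 = 2 * m + (2 * m + 2)" "4 * m + 2 = 2 * (2 * m) + 2" by simp_all
    then have "(pderiv ^^ (2 * m)) (gegenbauer (2 * m)) = [:fact (4 * m + 2):]"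
      using higher_pderiv_bump_top[of "2 * m"] by (simp only: gegenbauer_def funpow_add o_apply)
    then show ?thesis by (simp add: disc_harmonic_def particular_at_0)
  qed
  then show "node (2 * m) 0 = (-1) ^ m * fact (4 * m + 2)" "flux (2 * m) 0 = 0"
    by (simp_all add: node_def flux_def element_form_def pderiv_pCons)
qed

lemma odd_values_at_0:
  "node (2 * m + 1) 0 = (-1) ^ m * fact (4 * m + 4) / 2"
  "flux (2 * m + 1) 0 = (-1) ^ m * fact (4 * m + 4)"
proof -
  define P where "P = (pderiv ^^ (4 * m + 3)) (bump (2 * m + 1))"
  have dP: "pderiv P = [:fact (4 * m + 4):]"
  proof -
    have "2 * (2 * m + 1) + 2 = Suc (4 * m + 3)" "4 * m + 4 = 2 * (2 * m + 1) + 2" by simp_all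
    then show ?thesis
      using higher_pderiv_bump_top[of "2 * m + 1"] by (simp only: P_def funpow.simps o_apply)
  qed
  have "4 * m + 3 = 2 * m + (2 * m + 1 + 2)" by simp
  then have "P = (pderiv ^^ (2 * m)) (gegenbauer (2 * m + 1))"
    by (simp only: P_def gegenbauer_def funpow_add o_apply)
  then have d: "disc_harmonic (2 * m + 1) 0 = smult ((-1) ^ m) P"
    by (simp add: disc_harmonic_def particular_at_0)
  have "reflect P = - P"
    using reflect_higher_pderiv_bump[of "4 * m + 3" "2 * m + 1"] by (simp add: P_def)
  from arg_cong[OF this, of "\<lambda>p. poly p (1/2)"] have "poly P (-(1/2)) = - poly P (1/2)"
    by (simp add: poly_pcompose)
  moreover have I: "ref_int [:fact (4 * m + 4):] = fact (4 * m + 4)"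
    using ref_int_pderiv[of "[:0, fact (4 * m + 4):]"] by (simp add: pderiv_pCons field_simps)
  moreover have "ref_int (pderiv P) = poly P (1/2) - poly P (-(1/2))" by (rule ref_int_pderiv)
  ultimately have "poly P (1/2) = fact (4 * m + 4) / 2" by (simp add: dP)
  then show "node (2 * m + 1) 0 = (-1) ^ m * fact (4 * m + 4) / 2" 
    unfolding node_def d by simp
  show "flux (2 * m + 1) 0 = (-1) ^ m * fact (4 * m + 4)"
    unfolding flux_def element_form_def d
    by (simp add: pderiv_smult dP pderiv_pCons) (metis I ref_int_smult smult_pCons smult_0_right)
qed

section \<open>Moments of the Rodrigues weight\<close>

lemma ref_int_one: "ref_int 1 = 1"
  using ref_int_pderiv[of "[:0, 1:]"] by (simp add: pderiv_pCons one_pCons)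

text \<open>The recursion in \<open>n\<close> follows from integrating the derivative of \<open>y (y\<^sup>2 - 1/4)^(n+1)\<close>, which is zero at
both ends.\<close>

lemma ref_int_quadratic_power:
  "ref_int ([:-1/4, 0, 1:] ^ n) = (-1) ^ n * (fact n)\<^sup>2 / fact (2 * n + 1)"
proof (induction n)
  case 0
  show ?case by (simp add: ref_int_one)
next
  case (Suc n)
  define w :: "complex poly" where "w = [:-1/4, 0, 1:]"
  define c where "c = complex_of_nat (Suc n)"
  have "pderiv ([:0, 1:] * w ^ Suc n) = w ^ Suc n + smult c ([:0, 1:] * (w ^ n * pderiv w))"
    by (simp only: pderiv_mult pderiv_power_Suc c_def) (simp add: pderiv_pCons)
  also have "[:0, 1:] * (w ^ n * pderiv w) = smult 2 (w ^ Suc n) + smult (1/2) (w ^ n)"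
  proof -
    have "[:0, 1:] * pderiv w = smult 2 w + [:1/2:]" by (simp add: w_def pderiv_pCons)
    then have "w ^ n * ([:0, 1:] * pderiv w) = w ^ n * (smult 2 w + [:1/2:])" by simp
    then show ?thesis by (simp add: algebra_simps)
  qed
  finally have "pderiv ([:0, 1:] * w ^ Suc n) =
      smult (1 + 2 * c) (w ^ Suc n) + smult (c / 2) (w ^ n)"
    by (simp add: smult_add_right smult_add_left mult.commute)
  moreover have "ref_int (pderiv ([:0, 1:] * w ^ Suc n)) = 0"
    by (simp add: ref_int_pderiv w_def)
  ultimately have "(1 + 2 * c) * ref_int (w ^ Suc n) = - (c / 2 * ref_int (w ^ n))"
    by (simp only: ref_int_add ref_int_smult eq_neg_iff_add_eq_0)
  moreover have nz: "1 + 2 * c \<noteq> 0"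
  proof -
    have "1 + 2 * c = of_nat (2 * n + 3)" by (simp add: c_def)
    then show ?thesis by (simp only: of_nat_eq_0_iff)
  qed
  ultimately have "ref_int (w ^ Suc n) = - (c / 2 * ref_int (w ^ n)) / (1 + 2 * c)"
    by (metis nonzero_mult_div_cancel_left)
  also have "\<dots> = - (c / 2 * ((-1) ^ n * (fact n)\<^sup>2 / fact (2 * n + 1))) / (1 + 2 * c)"
    by (simp only: w_def Suc.IH)
  also have "\<dots> = (-1) ^ Suc n * (fact (Suc n))\<^sup>2 / fact (2 * Suc n + 1)"
  proof -
    have f1: "(fact (Suc n))\<^sup>2 = c\<^sup>2 * (fact n)\<^sup>2" by (simp add: c_def power_mult_distrib)
    have f2: "fact (2 * Suc n + 1) = (1 + 2 * c) * (2 * c) * fact (2 * n + 1)"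
    proof -
      have "2 * Suc n + 1 = Suc (Suc (2 * n + 1))" by simp
      then have "fact (2 * Suc n + 1) =
          of_nat (Suc (Suc (2 * n + 1))) * (of_nat (Suc (2 * n + 1)) * (fact (2 * n + 1) :: complex))"
        by (simp only: fact_Suc)
      also have "of_nat (Suc (Suc (2 * n + 1))) = 1 + 2 * c" by (simp add: c_def)
      also have "of_nat (Suc (2 * n + 1)) = 2 * c" by (simp add: c_def)
      finally show ?thesis by simp
    qed
    have "c \<noteq> 0" unfolding c_def of_nat_eq_0_iff by simp
    have "- (c / 2 * (s * f / F)) / e = - s * (c\<^sup>2 * f) / (e * (2 * c) * F)"
      if "e \<noteq> 0" "F \<noteq> 0" for s f F e :: complex
      using that \<open>c \<noteq> 0\<close> by (simp add: power2_eq_square field_simps)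
    from this[OF nz fact_nonzero] have "- (c / 2 * ((-1) ^ n * (fact n)\<^sup>2 / fact (2 * n + 1))) / (1 + 2 * c) =
        - ((-1) ^ n) * (c\<^sup>2 * (fact n)\<^sup>2) / ((1 + 2 * c) * (2 * c) * fact (2 * n + 1))" .
    then show ?thesis
      by (simp only: power_Suc mult_minus1 f1 f2)
  qed
  finally show ?case by (simp only: w_def)
qed

lemma moment_at_0:
  "moment d 0 = (-1) ^ (d + 1) * (fact (d + 1))\<^sup>2 / fact (2 * d + 3)"
  using ref_int_quadratic_power[of "d + 1"] by (simp add: moment_def ref_int_def bump_def numeral_3_eq_3)

text \<open>There is no linear term since the weight is even.\<close>

lemma moment_quadratic:
  assumes "norm z \<le> 1"
  shows "norm (moment d z - moment d 0) \<le> exp 1 * norm z ^ 2"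
proof -
  define g where "g = (\<lambda>y::real. poly (bump d) (of_real y) *
    (exp (\<i> * z * of_real y) - 1 - \<i> * z * of_real y))"
  have "ref_int ([:0, 1:] * bump d) = 0"
  proof -
    have "reflect ([:0, 1:] * bump d) = - ([:0, 1:] * bump d)"
      by (simp only: pcompose_mult reflect_bump) (simp add: pcompose_pCons)
    then have "ref_int ([:0, 1:] * bump d) = ref_int (smult (-1) ([:0, 1:] * bump d))"
      by (metis ref_int_reflect smult_1_left smult_minus_left)
    then show ?thesis by (simp only: ref_int_smult) simp
  qed
  then have odd: "integral {-(1/2)..1/2} (\<lambda>y::real. of_real y * poly (bump d) (of_real y)) = 0"
    by (simp add: ref_int_def)
  have "integral {-(1/2)..1/2} g =
      integral {-(1/2)..1/2} (\<lambda>y::real. poly (bump d) (of_real y) * exp (\<i> * z * of_real y))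
      - integral {-(1/2)..1/2} (\<lambda>y::real. poly (bump d) (of_real y))
      - integral {-(1/2)..1/2} (\<lambda>y::real. \<i> * z * (of_real y * poly (bump d) (of_real y)))"
  proof -
    have i: "(\<lambda>y::real. poly (bump d) (of_real y) * exp (\<i> * z * of_real y)) integrable_on {-(1/2)..1/2}"
      "(\<lambda>y::real. \<i> * z * (of_real y * poly (bump d) (of_real y))) integrable_on {-(1/2)..1/2}"
      by (intro integrable_continuous_real continuous_intros)+
    have "g = (\<lambda>y. poly (bump d) (of_real y) * exp (\<i> * z * of_real y) - poly (bump d) (of_real y)
        - \<i> * z * (of_real y * poly (bump d) (of_real y)))"
      by (simp add: g_def algebra_simps)
    then show ?thesis
      by (simp only: integral_diff[OF integrable_diff[OF i(1) poly_integrable] i(2)]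
          integral_diff[OF i(1) poly_integrable])
  qed
  also have "\<dots> = moment d z - moment d 0"
    by (simp only: integral_mult_right odd) (simp add: moment_def)
  finally have "moment d z - moment d 0 = integral {-(1/2)..1/2} g" ..
  also have "norm (integral {-(1/2)..1/2} g) \<le> exp 1 * norm z ^ 2 * (1/2 - -(1/2))"
  proof (rule integral_bound)
    show "continuous_on {-(1/2)..1/2} g" unfolding g_def by (intro continuous_intros)
  next
    fix y :: real assume y: "y \<in> {-(1/2)..1/2}"
    then have y1: "\<bar>y\<bar> \<le> 1" "y\<^sup>2 \<le> 1/4"
      using abs_le_square_iff[of y "1/2"] by (auto simp: power2_eq_square)
    have "\<bar>y\<^sup>2 - 1/4\<bar> \<le> 1" using y1(2) zero_le_power2[of y] unfolding abs_le_iff by linarith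
    then have "\<bar>y\<^sup>2 - 1/4\<bar> ^ (d + 1) \<le> 1" by (intro power_le_one) auto
    moreover have "poly (bump d) (of_real y) = of_real ((y\<^sup>2 - 1/4) ^ (d + 1))"
    proof -
      have "poly [:-1/4, 0, 1:] (of_real y) = complex_of_real (y\<^sup>2 - 1/4)"
        by (simp add: power2_eq_square)
      then show ?thesis by (simp only: bump_def poly_power of_real_power)
    qed
    ultimately have b: "norm (poly (bump d) (of_real y)) \<le> 1"
      by (simp only: norm_of_real power_abs)
    have w: "norm (\<i> * z * of_real y) \<le> norm z"
      using y1(1) by (simp add: norm_mult mult_left_le)
    have "norm (exp (\<i> * z * of_real y) - 1 - \<i> * z * of_real y)
        \<le> exp \<bar>Re (\<i> * z * of_real y)\<bar> * norm (\<i> * z * of_real y) ^ 2"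
      using Taylor_exp[of "\<i> * z * of_real y" 1] by (simp add: power2_eq_square diff_diff_eq)
    also have "\<dots> \<le> exp 1 * norm z ^ 2"
    proof (rule mult_mono)
      have "\<bar>Re (\<i> * z * of_real y)\<bar> \<le> 1"
        using abs_Re_le_cmod[of "\<i> * z * of_real y"] w assms by linarith
      then show "exp \<bar>Re (\<i> * z * of_real y)\<bar> \<le> exp 1" by simp
    qed (use w in \<open>auto intro: power_mono\<close>)
    finally have e: "norm (exp (\<i> * z * of_real y) - 1 - \<i> * z * of_real y) \<le> exp 1 * norm z ^ 2" .
    show "norm (g y) \<le> exp 1 * norm z ^ 2"
      using mult_mono[OF b e] unfolding g_def norm_mult by simp
  qed simp
  finally show ?thesis by simp
qed

section \<open>Finite element functions and their local pieces\<close>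

text \<open>On the mesh element from \<open>j h\<close> to \<open>(j + 1) h\<close>, the function \<open>u\<close> is the polynomial \<open>q\<close> in the coordinate
that maps this element to the reference element.\<close>

definition on_element :: "real \<Rightarrow> int \<Rightarrow> (real \<Rightarrow> complex) \<Rightarrow> complex poly \<Rightarrow> bool" where
  "on_element h j u q \<longleftrightarrow>
     (\<forall>x\<in>{of_int j * h..of_int (j + 1) * h}. u x = poly q (of_real (x / h - of_int j - 1/2)))"

text \<open>The same polynomial in the physical variable.\<close>

definition to_mesh :: "real \<Rightarrow> int \<Rightarrow> complex poly \<Rightarrow> complex poly" where
  "to_mesh h j q = pcompose q [: - (of_int j + 1/2), of_real (1 / h):]"

lemma poly_to_mesh:
  "poly (to_mesh h j q) (of_real x) = poly q (of_real (x / h - of_int j - 1/2))"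
  by (simp add: to_mesh_def poly_pcompose algebra_simps)

lemma fe_space_iff:
  assumes "h > 0"
  shows "u \<in> fe_space p h \<longleftrightarrow>
    continuous_on UNIV u \<and> (\<forall>j. \<exists>q. degree q \<le> p \<and> on_element h j u q)"
proof -
  have "(\<exists>q::complex poly. degree q \<le> p \<and>
           (\<forall>x\<in>{of_int j * h..of_int (j + 1) * h}. u x = poly q (complex_of_real x)))
        \<longleftrightarrow> (\<exists>q. degree q \<le> p \<and> on_element h j u q)" (is "?L \<longleftrightarrow> ?R") for j
  proof
    assume ?L
    then obtain q where q: "degree q \<le> p"
      "\<And>x. x \<in> {of_int j * h..of_int (j + 1) * h} \<Longrightarrow> u x = poly q (of_real x)" by blast
    define q' where "q' = pcompose q [:of_real ((of_int j + 1/2) * h), of_real h:]"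
    have "poly q' (of_real (x / h - of_int j - 1/2)) = poly q (of_real x)" for x
    proof -
      have "(of_int j + 1/2) * h + (x / h - of_int j - 1/2) * h = x"
        using assms by (simp add: field_simps)
      then have "complex_of_real ((of_int j + 1/2) * h) + of_real (x / h - of_int j - 1/2) * of_real h
          = of_real x"
        by (metis of_real_add of_real_mult)
      then show ?thesis unfolding q'_def poly_pcompose by simp
    qed
    moreover have "degree q' \<le> p"
      unfolding q'_def degree_pcompose using q(1) assms by simp
    ultimately show ?R using q(2) unfolding on_element_def by metis
  next
    assume ?R
    then obtain q where "degree q \<le> p" "on_element h j u q" by blast
    then show ?L
      using assms
      by (intro exI[of _ "to_mesh h j q"])
        (auto simp: poly_to_mesh on_element_def, simp add: to_mesh_def degree_pcompose)
  qed
  then show ?thesis by (simp add: fe_space_def)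
qed

lemma continuous_on_if_on_element:
  assumes "h > 0" and "\<And>j. \<exists>q. on_element h j u q"
  shows "continuous_on UNIV u"
proof -
  have elem: "continuous_on {of_int j * h..of_int (j + 1) * h} u" for j :: int
  proof -
    obtain q where "on_element h j u q" using assms(2) by blast
    then have eq: "u x = poly (to_mesh h j q) (of_real x)" if "x \<in> {of_int j * h..of_int (j + 1) * h}" for x
      using that by (simp only: on_element_def poly_to_mesh)
    show ?thesis
      by (rule continuous_on_eq[OF continuous_on_poly_of_real eq[symmetric]])
  qed
  have "isCont u x" for x
  proof -
    define j where "j = \<lfloor>x / h\<rfloor>"
    have j: "of_int j \<le> x / h" "x / h < of_int j + 1" unfolding j_def by linarith+
    have "{of_int (j - 1) * h..of_int j * h} \<union> {of_int j * h..of_int (j + 1) * h}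
        = {of_int (j - 1) * h..of_int (j + 1) * h}"
      using assms(1) by (intro ivl_disj_un_two_touch) (simp_all add: mult_right_mono)
    then have "continuous_on {of_int (j - 1) * h..of_int (j + 1) * h} u"
      using continuous_on_closed_Un[OF _ _ elem[of "j - 1"] elem[of j]] by simp
    moreover have "x \<in> interior {of_int (j - 1) * h..of_int (j + 1) * h}"
      using j assms(1) by (simp add: interior_atLeastAtMost_real field_simps)
    ultimately show ?thesis by (rule continuous_on_interior)
  qed
  then show ?thesis by (simp add: continuous_at_imp_continuous_on)
qed

lemma fe_spaceI:
  assumes "h > 0" and "\<And>j. degree (r j) \<le> p" and "\<And>j. on_element h j u (r j)"
  shows "u \<in> fe_space p h"
  using assms continuous_on_if_on_element[of h u] by (auto simp: fe_space_iff)

text \<open>The function on the line with given local pieces. Nodes are assigned to the element on their right.\<close>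

definition glue :: "real \<Rightarrow> (int \<Rightarrow> complex poly) \<Rightarrow> real \<Rightarrow> complex" where
  "glue h r x = poly (r \<lfloor>x / h\<rfloor>) (of_real (x / h - of_int \<lfloor>x / h\<rfloor> - 1/2))"

lemma on_element_glue:
  assumes "h > 0" and match: "\<And>j. poly (r j) (1/2) = poly (r (j + 1)) (-(1/2))"
  shows "on_element h j (glue h r) (r j)"
  unfolding on_element_def
proof
  fix x assume x: "x \<in> {of_int j * h..of_int (j + 1) * h}"
  then have x': "of_int j \<le> x / h" "x / h \<le> of_int j + 1"
    using assms(1) by (simp_all add: field_simps)
  show "glue h r x = poly (r j) (of_real (x / h - of_int j - 1/2))"
  proof (cases "x / h = of_int j + 1")
    case True
    then have "\<lfloor>x / h\<rfloor> = j + 1" by linarith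
    then show ?thesis by (simp add: glue_def True match)
  next
    case False
    with x' have "\<lfloor>x / h\<rfloor> = j" by linarith
    then show ?thesis by (simp add: glue_def)
  qed
qed

lemma on_element_cnj:
  "on_element h j (\<lambda>x. cnj (u x)) (map_poly cnj q) \<longleftrightarrow> on_element h j u q"
  by (simp add: on_element_def)

lemma on_element_value:
  assumes "h > 0" "on_element h j u q" "y \<in> {-(1/2)..1/2}"
  shows "u ((y + of_int j + 1/2) * h) = poly q (of_real y)"
proof -
  have "(y + of_int j + 1/2) * h \<in> {of_int j * h..of_int (j + 1) * h}"
    using assms(1,3) by (simp add: mult_right_mono)
  then have "u ((y + of_int j + 1/2) * h) = poly q (of_real ((y + of_int j + 1/2) * h / h - of_int j - 1/2))"
    using assms(2) unfolding on_element_def by blast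
  then show ?thesis using assms(1) by simp
qed

lemma on_element_nodes:
  assumes "h > 0" "on_element h j u q"
  shows "poly q (-(1/2)) = u (of_int j * h)" "poly q (1/2) = u (of_int (j + 1) * h)"
  using on_element_value[OF assms, of "-(1/2)"] on_element_value[OF assms, of "1/2"]
  by (simp_all add: add.commute)

lemma on_element_vector_derivative:
  assumes "h > 0" "on_element h j u q" "x \<in> {of_int j * h<..<of_int (j + 1) * h}"
  shows "(u has_vector_derivative
    poly (pderiv q) (of_real (x / h - of_int j - 1/2)) / of_real h) (at x)"
proof -
  have "((\<lambda>x. poly (to_mesh h j q) (of_real x)) has_vector_derivative
      poly (pderiv (to_mesh h j q)) (of_real x)) (at x)"
    by (rule poly_has_vector_derivative)
  moreover have "poly (pderiv (to_mesh h j q)) (of_real x) =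
      poly (pderiv q) (of_real (x / h - of_int j - 1/2)) / of_real h"
    using poly_to_mesh[of h j "pderiv q" x]
    by (simp add: to_mesh_def pderiv_pcompose pderiv_pCons)
  ultimately have "((\<lambda>x. poly (to_mesh h j q) (of_real x)) has_vector_derivative
      poly (pderiv q) (of_real (x / h - of_int j - 1/2)) / of_real h) (at x)" by simp
  then show ?thesis
    by (rule has_vector_derivative_transform_within_open[OF _ open_greaterThanLessThan assms(3)])
      (use assms(2) in \<open>simp add: on_element_def poly_to_mesh\<close>)
qed

lemma has_integral_on_element:
  assumes "h > 0"
  shows "((\<lambda>x. poly q (of_real (x / h - of_int j - 1/2))) has_integral of_real h * ref_int q)
    {of_int j * h..of_int (j + 1) * h}"
proof -
  have "((\<lambda>y::real. poly q (of_real y)) has_integral ref_int q) (cbox (-(1/2)) (1/2))"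
    unfolding ref_int_def box_real by (rule integrable_integral) simp
  from has_integral_affinity'[OF this, of "1 / h" "- of_int j - 1/2"] assms
  have "((\<lambda>x. poly q (of_real ((1 / h) *\<^sub>R x + (- of_int j - 1/2)))) has_integral
      ref_int q /\<^sub>R (1 / h)) (cbox ((-(1/2) - (- of_int j - 1/2)) /\<^sub>R (1 / h)) ((1/2 - (- of_int j - 1/2)) /\<^sub>R (1 / h)))"
    by simp
  moreover have "(1 / h) *\<^sub>R x + (- of_int j - 1/2) = x / h - of_int j - 1/2" for x by simp
  moreover have "(-(1/2) - (- of_int j - 1/2)) /\<^sub>R (1 / h) = of_int j * h"
    "(1/2 - (- of_int j - 1/2)) /\<^sub>R (1 / h) = of_int (j + 1) * h" by (simp_all add: algebra_simps)
  moreover have "ref_int q /\<^sub>R (1 / h) = of_real h * ref_int q" by (simp add: scaleR_conv_of_real)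
  ultimately show ?thesis by (simp only: box_real)
qed

lemma has_integral_pairing_on_element:
  assumes h: "h > 0" and u: "on_element h j u q" and v: "on_element h j (\<lambda>x. cnj (v x)) r"
  shows "((\<lambda>x. vector_derivative u (at x) * cnj (vector_derivative v (at x))) has_integral
      ref_int (pderiv q * pderiv r) / of_real h) {of_int j * h..of_int (j + 1) * h}"
    and "((\<lambda>x. u x * cnj (v x)) has_integral of_real h * ref_int (q * r))
      {of_int j * h..of_int (j + 1) * h}"
proof -
  show "((\<lambda>x. u x * cnj (v x)) has_integral of_real h * ref_int (q * r))
      {of_int j * h..of_int (j + 1) * h}"
    by (rule has_integral_eq[OF _ has_integral_on_element[OF h]])
      (use u v in \<open>simp add: on_element_def\<close>)
  have "((\<lambda>x. poly (smult (1 / (of_real h)\<^sup>2) (pderiv q * pderiv r)) (of_real (x / h - of_int j - 1/2)))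
      has_integral of_real h * ref_int (smult (1 / (of_real h)\<^sup>2) (pderiv q * pderiv r)))
      {of_int j * h..of_int (j + 1) * h}"
    by (rule has_integral_on_element[OF h])
  moreover have "of_real h * ref_int (smult (1 / (of_real h)\<^sup>2) (pderiv q * pderiv r)) =
      ref_int (pderiv q * pderiv r) / of_real h"
    using h by (simp add: ref_int_smult power2_eq_square)
  ultimately have I: "((\<lambda>x. poly (smult (1 / (of_real h)\<^sup>2) (pderiv q * pderiv r)) (of_real (x / h - of_int j - 1/2)))
      has_integral ref_int (pderiv q * pderiv r) / of_real h) {of_int j * h..of_int (j + 1) * h}"
    by simp
  show "((\<lambda>x. vector_derivative u (at x) * cnj (vector_derivative v (at x))) has_integral
      ref_int (pderiv q * pderiv r) / of_real h) {of_int j * h..of_int (j + 1) * h}"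
  proof (rule has_integral_spike_finite[OF _ _ I, of "{of_int j * h, of_int (j + 1) * h}"])
    fix x assume "x \<in> {of_int j * h..of_int (j + 1) * h} - {of_int j * h, of_int (j + 1) * h}"
    then have x: "x \<in> {of_int j * h<..<of_int (j + 1) * h}" by auto
    have "vector_derivative u (at x) = poly (pderiv q) (of_real (x / h - of_int j - 1/2)) / of_real h"
      by (rule vector_derivative_at[OF on_element_vector_derivative[OF h u x]])
    moreover have "vector_derivative v (at x) =
        cnj (poly (pderiv r) (of_real (x / h - of_int j - 1/2)) / of_real h)"
      using has_vector_derivative_cnj[OF on_element_vector_derivative[OF h v x]]
      by (intro vector_derivative_at) simp
    ultimately show "vector_derivative u (at x) * cnj (vector_derivative v (at x)) =
        poly (smult (1 / (of_real h)\<^sup>2) (pderiv q * pderiv r)) (of_real (x / h - of_int j - 1/2))"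
      by (simp only: complex_cnj_cnj) (simp add: power2_eq_square)
  qed simp
qed

lemma has_integral_sum_elements:
  fixes f :: "real \<Rightarrow> complex" and a :: int
  assumes "h > 0" and "\<And>j::int. (f has_integral i j) {of_int j * h..of_int (j + 1) * h}"
  shows "(f has_integral (\<Sum>k<n. i (a + int k))) {of_int a * h..of_int (a + int n) * h}"
proof (induction n)
  case 0
  show ?case by (simp add: has_integral_refl)
next
  case (Suc n)
  have "(f has_integral (\<Sum>k<n. i (a + int k)) + i (a + int n)) {of_int a * h..of_int (a + int n + 1) * h}"
    by (rule has_integral_combine[OF _ _ Suc.IH assms(2)]) (use assms(1) in \<open>simp_all add: mult_right_mono\<close>)
  moreover have "a + int n + 1 = a + int (Suc n)" by simp
  ultimately show ?case by (simp only: sum.lessThan_Suc)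
qed

text \<open>The global form is the sum of the element forms. The unspecified derivatives at the nodes do not
matter, since the integrals ignore finitely many points.\<close>

lemma fe_form_eq_sum:
  fixes a :: int and n :: nat
  assumes h: "h > 0" and u: "\<And>j. on_element h j u (q j)"
    and v: "\<And>j. on_element h j (\<lambda>x. cnj (v x)) (r j)"
    and supp: "\<And>x. x \<notin> {of_int a * h..of_int (a + int n) * h} \<Longrightarrow> v x = 0"
  shows "integral UNIV (\<lambda>x. vector_derivative u (at x) * cnj (vector_derivative v (at x)))
       - \<omega>\<^sup>2 * integral UNIV (\<lambda>x. u x * cnj (v x)) =
    (\<Sum>k<n. element_form ((\<omega> * of_real h)\<^sup>2) (q (a + int k)) (r (a + int k))) / of_real h"
proof -
  let ?S = "{of_int a * h..of_int (a + int n) * h}"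
  have dv: "vector_derivative v (at x) = 0" if "x \<notin> ?S" for x
  proof -
    have "(v has_vector_derivative 0) (at x)"
      by (rule has_vector_derivative_transform_within_open[OF has_vector_derivative_const, of "- ?S"])
        (use that supp in auto)
    then show ?thesis by (rule vector_derivative_at)
  qed
  have "((\<lambda>x. vector_derivative u (at x) * cnj (vector_derivative v (at x))) has_integral
      (\<Sum>k<n. ref_int (pderiv (q (a + int k)) * pderiv (r (a + int k))) / of_real h)) UNIV"
    by (rule has_integral_on_superset[OF has_integral_sum_elements[OF h
          has_integral_pairing_on_element(1)[OF h u v]]]) (simp_all add: dv)
  moreover have "((\<lambda>x. u x * cnj (v x)) has_integral
      (\<Sum>k<n. of_real h * ref_int (q (a + int k) * r (a + int k)))) UNIV"
    by (rule has_integral_on_superset[OF has_integral_sum_elements[OF h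
          has_integral_pairing_on_element(2)[OF h u v]]]) (simp_all add: supp)
  ultimately have "integral UNIV (\<lambda>x. vector_derivative u (at x) * cnj (vector_derivative v (at x)))
       - \<omega>\<^sup>2 * integral UNIV (\<lambda>x. u x * cnj (v x)) =
     (\<Sum>k<n. ref_int (pderiv (q (a + int k)) * pderiv (r (a + int k))) / of_real h) -
     \<omega>\<^sup>2 * (\<Sum>k<n. of_real h * ref_int (q (a + int k) * r (a + int k)))"
    by (simp only: integral_unique)
  also have "\<dots> = (\<Sum>k<n. element_form ((\<omega> * of_real h)\<^sup>2) (q (a + int k)) (r (a + int k)) / of_real h)"
    unfolding sum_distrib_left sum_subtractf[symmetric]
    using h by (intro sum.cong) (simp_all add: element_form_def diff_divide_distrib power2_eq_square)
  finally show ?thesis by (simp only: sum_divide_distrib)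
qed

section \<open>Reduction of discrete waves to one element\<close>

text \<open>A wave with multiplier \<open>l = exp (\<i> k h)\<close> is determined by its piece \<open>q\<close> on a single element, as the piece
on element \<open>j\<close> is \<open>l^j q\<close>. What remains of the discrete equations are continuity, the equations for
bubbles, and the balance of the fluxes at one node.\<close>

definition local_wave :: "nat \<Rightarrow> complex \<Rightarrow> complex \<Rightarrow> complex poly \<Rightarrow> bool" where
  "local_wave p Z l q \<longleftrightarrow> degree q \<le> p \<and> q \<noteq> 0 \<and> poly q (1/2) = l * poly q (-(1/2)) \<and>
     (\<forall>b. bubble p b \<longrightarrow> element_form Z q b = 0) \<and> element_form Z q right_hat + l * element_form Z q left_hat = 0"

text \<open>Test functions supported in the two elements next to the origin suffice: bubbles on one of them,
and the hat function of the node at the origin.\<close>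

lemma local_wave_of_discrete_wave:
  assumes h: "h > 0" and p: "p \<ge> 1" and wave: "discrete_wave p h \<omega> k u"
  defines "l \<equiv> exp (\<i> * k * complex_of_real h)"
  obtains q where "local_wave p ((\<omega> * of_real h)\<^sup>2) l q"
proof -
  have l: "l \<noteq> 0" by (simp add: l_def)
  have shift: "u (x + h) = l * u x" for x
    using wave by (simp add: discrete_wave_def l_def)
  have shifts: "u (x + of_int j * h) = l powi j * u x" for x and j :: int
  proof (induction j rule: int_induct[where k = 0])
    case base
    show ?case by simp
  next
    case (step1 i)
    have "u (x + of_int (i + 1) * h) = u (x + of_int i * h + h)" by (simp add: algebra_simps)
    then show ?case using step1 l by (simp add: shift power_int_add_1')
  next
    case (step2 i)
    have "l * u (x + of_int (i - 1) * h) = u (x + of_int i * h)"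
      using shift[of "x + of_int (i - 1) * h"] by (simp add: algebra_simps)
    also have "\<dots> = l * (l powi (i - 1) * u x)"
      using step2 l by (simp add: power_int_diff)
    finally show ?case using l by simp
  qed
  have "u \<in> fe_space p h" using wave by (simp add: discrete_wave_def fe_solution_def)
  then obtain q where q: "degree q \<le> p" "on_element h 0 u q" using fe_space_iff[OF h] by blast
  have u: "on_element h j u (smult (l powi j) q)" for j
    unfolding on_element_def
  proof
    fix x assume "x \<in> {of_int j * h..of_int (j + 1) * h}"
    then have "x - of_int j * h \<in> {of_int 0 * h..of_int (0 + 1) * h}" by (auto simp: algebra_simps)
    then have "u (x - of_int j * h) = poly q (of_real ((x - of_int j * h) / h - of_int 0 - 1/2))"
      using q(2) unfolding on_element_def by blast
    also have "(x - of_int j * h) / h - of_int 0 - 1/2 = x / h - of_int j - 1/2"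
      using h by (simp add: field_simps)
    finally show "u x = poly (smult (l powi j) q) (of_real (x / h - of_int j - 1/2))"
      using shifts[of "x - of_int j * h" j] by simp
  qed
  have "q \<noteq> 0"
  proof
    assume "q = 0"
    have "u x = 0" for x
    proof -
      have "x \<in> {of_int \<lfloor>x / h\<rfloor> * h..of_int (\<lfloor>x / h\<rfloor> + 1) * h}"
      proof -
        have "of_int \<lfloor>x / h\<rfloor> \<le> x / h" "x / h \<le> of_int (\<lfloor>x / h\<rfloor> + 1)" by linarith+
        then show ?thesis
          unfolding pos_le_divide_eq[OF h] pos_divide_le_eq[OF h] atLeastAtMost_iff by blast
      qed
      with u[of "\<lfloor>x / h\<rfloor>"] \<open>q = 0\<close> show ?thesis by (simp add: on_element_def)
    qed
    with wave show False by (simp add: discrete_wave_def)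
  qed
  have match: "poly q (1/2) = l * poly q (-(1/2))"
    using on_element_nodes[OF h q(2)] shift[of 0] by simp
  have test: "element_form ((\<omega> * of_real h)\<^sup>2) q s + l * element_form ((\<omega> * of_real h)\<^sup>2) q t = 0"
    if st: "degree s \<le> p" "degree t \<le> p" "poly s (-(1/2)) = 0" "poly s (1/2) = poly t (-(1/2))"
      "poly t (1/2) = 0" for s t
  proof -
    define r where "r j = (if j = -1 then s else if j = 0 then t else 0)" for j :: int
    have r: "on_element h j (glue h r) (r j)" for j
      by (rule on_element_glue[OF h]) (simp add: r_def st)
    define v where "v = (\<lambda>x. cnj (glue h r x))"
    have v: "on_element h j (\<lambda>x. cnj (v x)) (r j)" for j using r by (simp add: v_def)
    have "v \<in> fe_space p h"
      by (rule fe_spaceI[OF h, of "\<lambda>j. map_poly cnj (r j)"])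
        (simp_all add: v_def on_element_cnj r, simp add: r_def st)
    have supp: "v x = 0" if "x \<notin> {of_int (-1) * h..of_int (-1 + int 2) * h}" for x
    proof -
      have "x / h < -1 \<or> x / h > 1" using that h by (auto simp: field_simps)
      then have "\<lfloor>x / h\<rfloor> \<noteq> -1" "\<lfloor>x / h\<rfloor> \<noteq> 0" by linarith+
      then show ?thesis by (simp add: v_def glue_def r_def)
    qed
    have "compact (closure {x. v x \<noteq> 0})"
    proof -
      have "{x. v x \<noteq> 0} \<subseteq> {of_int (-1) * h..of_int (-1 + int 2) * h}" using supp by blast
      then have "bounded {x. v x \<noteq> 0}" by (rule bounded_subset[OF bounded_closed_interval])
      then show ?thesis by (simp add: compact_closure)
    qed
    with wave \<open>v \<in> fe_space p h\<close>
    have "integral UNIV (\<lambda>x. vector_derivative u (at x) * cnj (vector_derivative v (at x)))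
       - \<omega>\<^sup>2 * integral UNIV (\<lambda>x. u x * cnj (v x)) = 0"
      by (simp add: discrete_wave_def fe_solution_def)
    with fe_form_eq_sum[where a = "-1" and n = 2 and \<omega> = \<omega>, OF h u v supp] h
    have "element_form ((\<omega> * of_real h)\<^sup>2) (smult (l powi (-1)) q) s + element_form ((\<omega> * of_real h)\<^sup>2) q t = 0"
      by (simp add: lessThan_nat_numeral lessThan_Suc r_def add.commute)
    then have "l * (l powi (-1) * element_form ((\<omega> * of_real h)\<^sup>2) q s + element_form ((\<omega> * of_real h)\<^sup>2) q t) = 0"
      by (simp only: element_form_smult_left) simp
    then show ?thesis using l by (simp add: distrib_left power_int_minus flip: mult.assoc)
  qed
  have "element_form ((\<omega> * of_real h)\<^sup>2) q b = 0" if "bubble p b" for b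
    using test[of b 0] that by (simp add: bubble_def)
  moreover have "element_form ((\<omega> * of_real h)\<^sup>2) q right_hat + l * element_form ((\<omega> * of_real h)\<^sup>2) q left_hat = 0"
    using p by (intro test) simp_all
  ultimately have "local_wave p ((\<omega> * of_real h)\<^sup>2) l q"
    using q(1) \<open>q \<noteq> 0\<close> match by (simp add: local_wave_def)
  then show ?thesis by (rule that)
qed

text \<open>Against an arbitrary test function the element contributions telescope, because the right flux
of \<open>q\<close> is \<open>- l\<close> times its left flux.\<close>

lemma discrete_wave_of_local_wave:
  fixes k \<omega> :: complex
  assumes h: "h > 0" and p: "p \<ge> 1"
  defines "l \<equiv> exp (\<i> * k * complex_of_real h)"
  assumes q: "local_wave p ((\<omega> * of_real h)\<^sup>2) l q"
  shows "\<exists>u. discrete_wave p h \<omega> k u"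
proof -
  define Z where "Z = (\<omega> * of_real h)\<^sup>2"
  have l: "l \<noteq> 0" by (simp add: l_def)
  have q': "degree q \<le> p" "q \<noteq> 0" "poly q (1/2) = l * poly q (-(1/2))"
    "\<And>b. bubble p b \<Longrightarrow> element_form Z q b = 0" "element_form Z q right_hat = - (l * element_form Z q left_hat)"
    using q by (auto simp: local_wave_def Z_def eq_neg_iff_add_eq_0)
  define u where "u = glue h (\<lambda>j. smult (l powi j) q)"
  have u: "on_element h j u (smult (l powi j) q)" for j
    unfolding u_def by (rule on_element_glue[OF h]) (use l in \<open>simp add: q'(3) power_int_add_1\<close>)
  have "u (x + h) = l * u x" for x
  proof -
    have "(x + h) / h = x / h + 1" using h by (simp add: field_simps)
    moreover have "\<lfloor>x / h + 1\<rfloor> = \<lfloor>x / h\<rfloor> + 1" by simp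
    ultimately show ?thesis using l by (simp add: u_def glue_def power_int_add_1')
  qed
  moreover have "\<exists>x. u x \<noteq> 0"
  proof (rule ccontr)
    assume "\<nexists>x. u x \<noteq> 0"
    then have "poly q (of_real y) = 0" if "y \<in> {-(1/2)..1/2}" for y
      using on_element_value[OF h u[of 0] that] by simp
    then have "q = 0" by (rule poly_eq_0_on_reference)
    with q'(2) show False by simp
  qed
  moreover have "fe_solution p h \<omega> u"
    unfolding fe_solution_def
  proof (intro conjI ballI impI)
    show "u \<in> fe_space p h"
      by (rule fe_spaceI[OF h _ u]) (rule order.trans[OF degree_smult_le q'(1)])
    fix v assume v: "v \<in> fe_space p h" and comp: "compact (closure {x. v x \<noteq> 0})"
    obtain s where s: "\<And>j. degree (s j) \<le> p" "\<And>j. on_element h j v (s j)"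
      using v fe_space_iff[OF h] by metis
    define r where "r j = map_poly cnj (s j)" for j
    have r: "on_element h j (\<lambda>x. cnj (v x)) (r j)" "degree (r j) \<le> p" for j
      using s by (simp_all add: r_def on_element_cnj)
    have "bounded {x. v x \<noteq> 0}"
      using comp by (meson bounded_subset closure_subset compact_imp_bounded)
    then obtain B where B: "\<And>x. v x \<noteq> 0 \<Longrightarrow> \<bar>x\<bar> \<le> B" by (auto simp: bounded_iff)
    \<comment> \<open>The test function vanishes at the nodes \<open>- N h\<close> and \<open>N h\<close>.\<close>
    obtain N :: nat where "B / h < real N" using reals_Archimedean2 by blast
    then have N: "B < real N * h" using h by (simp add: field_simps)
    have supp: "v x = 0" if "x \<notin> {of_int (- int N) * h..of_int (- int N + int (2 * N)) * h}" for x
      using B[of x] N that by (cases "v x = 0") auto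
    define F where "F j = l powi j * cnj (v (of_int j * h))" for j :: int
    have "element_form Z (smult (l powi j) q) (r j) = element_form Z q left_hat * (F j - F (j + 1))" for j
    proof -
      have "element_form Z q (r j) = cnj (v (of_int j * h)) * element_form Z q left_hat
          + cnj (v (of_int (j + 1) * h)) * element_form Z q right_hat"
        using element_form_of_nodal_values[OF q'(4) r(2) p] on_element_nodes[OF h r(1)[of j]] by simp
      moreover have "l powi (j + 1) = l powi j * l" using l by (simp add: power_int_add_1)
      ultimately show ?thesis
        unfolding element_form_smult_left F_def q'(5) by (simp only:) (simp add: algebra_simps)
    qed
    then have "(\<Sum>k<2 * N. element_form Z (smult (l powi (- int N + int k)) q) (r (- int N + int k))) =
        element_form Z q left_hat * (\<Sum>k<2 * N. F (- int N + int k) - F (- int N + int (Suc k)))"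
    proof -
      have "- int N + int k + 1 = - int N + int (Suc k)" for k by simp
      with \<open>\<And>j. element_form Z (smult (l powi j) q) (r j) = element_form Z q left_hat * (F j - F (j + 1))\<close>
      show ?thesis by (simp only: sum_distrib_left)
    qed
    also have "\<dots> = element_form Z q left_hat * (F (- int N) - F (int N))"
      using sum_lessThan_telescope'[of "\<lambda>k. F (- int N + int k)" "2 * N"] by simp
    also have "\<dots> = 0"
    proof -
      have "v (- (real N * h)) = 0" "v (real N * h) = 0"
        using B[of "- (real N * h)"] B[of "real N * h"] N h by fastforce+
      then show ?thesis by (simp add: F_def)
    qed
    finally have "(\<Sum>k<2 * N. element_form Z (smult (l powi (- int N + int k)) q) (r (- int N + int k))) = 0" .
    with fe_form_eq_sum[where a = "- int N" and n = "2 * N" and \<omega> = \<omega>, OF h u r(1) supp]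
    show "integral UNIV (\<lambda>x. vector_derivative u (at x) * cnj (vector_derivative v (at x)))
       - \<omega>\<^sup>2 * integral UNIV (\<lambda>x. u x * cnj (v x)) = 0"
      by (simp only: Z_def) simp
  qed
  ultimately show ?thesis by (auto simp: discrete_wave_def l_def)
qed

section \<open>The numerical cosine\<close>

text \<open>The even and the odd one of the two degrees \<open>p - 1\<close> and \<open>p\<close>.\<close>

definition even_deg :: "nat \<Rightarrow> nat" where
  "even_deg p = 2 * (p div 2)"

definition odd_deg :: "nat \<Rightarrow> nat" where
  "odd_deg p = 2 * ((p - 1) div 2) + 1"

lemma degrees_eq:
  assumes "p \<ge> 1"
  shows "even_deg p = p - 1 \<and> odd_deg p = p \<or> even_deg p = p \<and> odd_deg p = p - 1"
proof (cases "even p")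
  case True
  then obtain n where "p = 2 * n" by (rule evenE)
  moreover from this assms obtain m where "n = Suc m" by (cases n) auto
  ultimately show ?thesis by (simp add: even_deg_def odd_deg_def)
next
  case False
  then obtain n where "p = 2 * n + 1" by (rule oddE)
  then show ?thesis by (simp add: even_deg_def odd_deg_def)
qed

lemma deg_bounds:
  assumes "p \<ge> 1"
  shows "even_deg p \<le> p" "odd_deg p \<le> p" "p \<le> even_deg p + 1" "p \<le> odd_deg p + 1"
  using degrees_eq[OF assms] assms by auto

lemma even_odd_deg [simp]: "even (even_deg p)" "odd (odd_deg p)"
  by (simp_all add: even_deg_def odd_deg_def)

text \<open>Testing the local wave with the discrete harmonic polynomials and conversely, symmetry of the form
yields two linear relations between the nodal value \<open>a\<close> and the flux \<open>f\<close> at the left end; eliminating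
\<open>a\<close> and \<open>f\<close> gives the necessary condition. For the converse, the wave is a combination of the two
discrete harmonic polynomials. No uniqueness for the local problem with nonzero nodal values is
needed.\<close>

lemma ex_local_wave_iff:
  fixes p :: nat and Z l :: complex
  defines "e \<equiv> even_deg p" and "d \<equiv> odd_deg p"
  assumes p: "p \<ge> 1" and Z: "norm Z < 3/4" and l: "l \<noteq> 0"
    and ne: "node e Z \<noteq> 0" and no: "node d Z \<noteq> 0"
  shows "(\<exists>q. local_wave p Z l q) \<longleftrightarrow>
    flux e Z * node d Z * (1 + l)\<^sup>2 = flux d Z * node e Z * (1 - l)\<^sup>2"
proof -
  have par: "(-1) ^ e = (1::complex)" "(-1) ^ d = (-1::complex)"
    by (simp_all add: e_def d_def)
  have orth: "element_form Z (disc_harmonic e Z) b = 0" "element_form Z (disc_harmonic d Z) b = 0" if "bubble p b" for b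
    using that deg_bounds[OF p] by (auto intro: disc_harmonic_orthogonal_bubble simp: e_def d_def)
  have deg: "degree (disc_harmonic e Z) \<le> p" "degree (disc_harmonic d Z) \<le> p"
    using deg_bounds[OF p] degree_disc_harmonic[of e Z] degree_disc_harmonic[of d Z] by (simp_all add: e_def d_def)
  have nodes: "poly (disc_harmonic e Z) (1/2) = node e Z" "poly (disc_harmonic e Z) (-(1/2)) = node e Z"
    "poly (disc_harmonic d Z) (1/2) = node d Z" "poly (disc_harmonic d Z) (-(1/2)) = - node d Z"
    by (simp_all add: node_def[symmetric] disc_harmonic_left_node[of e] disc_harmonic_left_node[of d] par del: divide_minus_left)
  have flux: "element_form Z (disc_harmonic e Z) right_hat = flux e Z" "element_form Z (disc_harmonic e Z) left_hat = flux e Z"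
    "element_form Z (disc_harmonic d Z) right_hat = flux d Z" "element_form Z (disc_harmonic d Z) left_hat = - flux d Z"
    by (simp_all only: flux_def disc_harmonic_left_flux par mult_1_left mult_minus1)
  show ?thesis
  proof
    assume "\<exists>q. local_wave p Z l q"
    then obtain q where q: "degree q \<le> p" "q \<noteq> 0" "poly q (1/2) = l * poly q (-(1/2))"
      "\<And>b. bubble p b \<Longrightarrow> element_form Z q b = 0" "element_form Z q right_hat + l * element_form Z q left_hat = 0"
      unfolding local_wave_def by blast
    define a where "a = poly q (-(1/2))"
    define f where "f = element_form Z q left_hat"
    have right: "poly q (1/2) = l * a" "element_form Z q right_hat = - (l * f)"
      using q(3,5) by (simp_all add: a_def f_def eq_neg_iff_add_eq_0)
    \<comment> \<open>Otherwise both nodal values of \<open>q\<close> vanish, and \<open>q\<close> would be a harmonic bubble.\<close>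
    have "a \<noteq> 0"
    proof
      assume "a = 0"
      then have "bubble p q" using q(1,3) by (simp add: bubble_def a_def)
      from bubble_harmonic_eq_0[OF this q(4) Z] q(2) show False by simp
    qed
    have "element_form Z q (disc_harmonic e Z) = node e Z * f * (1 - l)"
      using element_form_of_nodal_values[OF q(4) deg(1) p] by (simp add: nodes right f_def[symmetric] algebra_simps)
    moreover have "element_form Z (disc_harmonic e Z) q = flux e Z * a * (1 + l)"
      using element_form_of_nodal_values[OF orth(1) q(1) p] by (simp add: flux right a_def[symmetric] algebra_simps)
    ultimately have E: "node e Z * f * (1 - l) = flux e Z * a * (1 + l)"
      by (simp only: element_form_commute)
    have "element_form Z q (disc_harmonic d Z) = - (node d Z * f * (1 + l))"
      using element_form_of_nodal_values[OF q(4) deg(2) p] by (simp add: nodes right f_def[symmetric] algebra_simps)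
    moreover have "element_form Z (disc_harmonic d Z) q = - (flux d Z * a * (1 - l))"
      using element_form_of_nodal_values[OF orth(2) q(1) p] by (simp add: flux right a_def[symmetric] algebra_simps)
    ultimately have O: "node d Z * f * (1 + l) = flux d Z * a * (1 - l)"
      by (metis element_form_commute neg_equal_iff_equal)
    have "a * (flux e Z * node d Z * (1 + l)\<^sup>2) = node d Z * (1 + l) * (flux e Z * a * (1 + l))"
      by (simp add: power2_eq_square)
    also have "\<dots> = node e Z * (1 - l) * (node d Z * f * (1 + l))" by (simp flip: E)
    also have "\<dots> = a * (flux d Z * node e Z * (1 - l)\<^sup>2)" by (simp add: O power2_eq_square)
    finally show "flux e Z * node d Z * (1 + l)\<^sup>2 = flux d Z * node e Z * (1 - l)\<^sup>2"
      using \<open>a \<noteq> 0\<close> by simp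
  next
    assume rel: "flux e Z * node d Z * (1 + l)\<^sup>2 = flux d Z * node e Z * (1 - l)\<^sup>2"
    \<comment> \<open>The coefficients are chosen so that \<open>q (1/2) = l q (-1/2)\<close>.\<close>
    define q where "q = smult (node d Z * (1 + l)) (disc_harmonic e Z) + smult (- (node e Z * (1 - l))) (disc_harmonic d Z)"
    have v: "poly q (1/2) = 2 * l * node e Z * node d Z" "poly q (-(1/2)) = 2 * node e Z * node d Z"
      by (simp_all add: q_def nodes algebra_simps)
    have b: "element_form Z q v = node d Z * (1 + l) * element_form Z (disc_harmonic e Z) v
        - node e Z * (1 - l) * element_form Z (disc_harmonic d Z) v" for v
      unfolding q_def element_form_add_left element_form_smult_left by simp
    have "q \<noteq> 0" using v(1) l ne no by auto
    moreover have "degree q \<le> p"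
      unfolding q_def by (intro degree_add_le order.trans[OF degree_smult_le]) (rule deg)+
    moreover have "element_form Z q right_hat + l * element_form Z q left_hat
        = flux e Z * node d Z * (1 + l)\<^sup>2 - flux d Z * node e Z * (1 - l)\<^sup>2"
      unfolding b flux by (simp add: power2_eq_square algebra_simps)
    ultimately have "local_wave p Z l q"
      unfolding local_wave_def using v rel b orth by simp
    then show "\<exists>q. local_wave p Z l q" by blast
  qed
qed

lemma node_poly: "\<exists>P. \<forall>Z. node d Z = poly P Z"
  unfolding node_def disc_harmonic_def by (rule particular_linear_functional) simp_all

lemma flux_poly: "\<exists>P. \<forall>Z. flux d Z = poly P Z"
proof -
  have "\<exists>P. \<forall>Z. ref_int (pderiv (disc_harmonic d Z) * pderiv right_hat) = poly P Z"
    unfolding disc_harmonic_def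
    by (rule particular_linear_functional[where l = "\<lambda>q. ref_int (pderiv q * pderiv right_hat)"])
      (simp_all only: pderiv_add pderiv_smult distrib_right mult_smult_left ref_int_add ref_int_smult)
  then obtain P where P: "\<And>Z. ref_int (pderiv (disc_harmonic d Z) * pderiv right_hat) = poly P Z"
    by blast
  have "\<exists>P. \<forall>Z. ref_int (disc_harmonic d Z * right_hat) = poly P Z"
    unfolding disc_harmonic_def
    by (rule particular_linear_functional[where l = "\<lambda>q. ref_int (q * right_hat)"])
      (simp_all only: distrib_right mult_smult_left ref_int_add ref_int_smult)
  then obtain Q where Q: "\<And>Z. ref_int (disc_harmonic d Z * right_hat) = poly Q Z"
    by blast
  have "\<forall>Z. flux d Z = poly (P - [:0, 1:] * Q) Z"
    by (simp only: flux_def element_form_def P Q) simp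
  then show ?thesis by blast
qed

text \<open>Numerator and denominator of the numerical cosine, as functions of \<open>Z = (\<omega> h)\<^sup>2\<close>. Near \<open>Z = 0\<close> their
quotient is \<open>(S_o + S_e) / (S_o - S_e)\<close>, where \<open>S_e\<close> and \<open>S_o\<close> are the ratios of flux and nodal value
for the even and for the odd degree.\<close>

definition cos_num :: "nat \<Rightarrow> complex \<Rightarrow> complex" where
  "cos_num p Z = flux (odd_deg p) Z * node (even_deg p) Z + flux (even_deg p) Z * node (odd_deg p) Z"

definition cos_den :: "nat \<Rightarrow> complex \<Rightarrow> complex" where
  "cos_den p Z = flux (odd_deg p) Z * node (even_deg p) Z - flux (even_deg p) Z * node (odd_deg p) Z"

lemma cos_num_poly: "\<exists>P. \<forall>Z. cos_num p Z = poly P Z"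
  and cos_den_poly: "\<exists>P. \<forall>Z. cos_den p Z = poly P Z"
proof -
  obtain A B C D where "\<And>Z. flux (odd_deg p) Z = poly A Z" "\<And>Z. node (even_deg p) Z = poly B Z"
    "\<And>Z. flux (even_deg p) Z = poly C Z" "\<And>Z. node (odd_deg p) Z = poly D Z"
    using node_poly flux_poly by metis
  then have "\<forall>Z. cos_num p Z = poly (A * B + C * D) Z" "\<forall>Z. cos_den p Z = poly (A * B - C * D) Z"
    by (simp_all add: cos_num_def cos_den_def)
  then show "\<exists>P. \<forall>Z. cos_num p Z = poly P Z" "\<exists>P. \<forall>Z. cos_den p Z = poly P Z" by blast+
qed

lemma even_deg_at_0:
  "node (even_deg p) 0 = (-1) ^ (even_deg p div 2) * fact (2 * even_deg p + 2)"
  "flux (even_deg p) 0 = 0"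
  using even_values_at_0[of "p div 2"] by (simp_all add: even_deg_def)

lemma odd_deg_at_0:
  "node (odd_deg p) 0 = flux (odd_deg p) 0 / 2"
  "flux (odd_deg p) 0 = (-1) ^ (odd_deg p div 2) * fact (2 * odd_deg p + 2)"
proof -
  define m where "m = (p - 1) div 2"
  have d: "odd_deg p = 2 * m + 1" by (simp add: odd_deg_def m_def)
  have "2 * (2 * m + 1) + 2 = 4 * m + 4" "(2 * m + 1) div 2 = m" by simp_all
  then show "flux (odd_deg p) 0 = (-1) ^ (odd_deg p div 2) * fact (2 * odd_deg p + 2)"
    "node (odd_deg p) 0 = flux (odd_deg p) 0 / 2"
    unfolding d by (simp_all only: odd_values_at_0)
qed

lemma cos_den_at_0: "cos_den p 0 = flux (odd_deg p) 0 * node (even_deg p) 0"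
  by (simp add: cos_den_def even_deg_at_0)

lemma values_at_0_nonzero:
  "node (even_deg p) 0 \<noteq> 0" "flux (odd_deg p) 0 \<noteq> 0" "node (odd_deg p) 0 \<noteq> 0" "cos_den p 0 \<noteq> 0"
  by (simp_all only: cos_den_at_0 even_deg_at_0 odd_deg_at_0 mult_eq_0_iff divide_eq_0_iff
      power_eq_0_iff fact_nonzero neg_equal_0_iff_equal one_neq_zero zero_neq_numeral[symmetric] simp_thms)

lemma eventually_poly_square_nonzero:
  fixes f :: "complex \<Rightarrow> complex"
  assumes "\<exists>P. \<forall>Z. f Z = poly P Z" "f 0 \<noteq> 0"
  shows "eventually (\<lambda>z. f (z\<^sup>2) \<noteq> 0) (nhds 0)"
proof -
  obtain P where P: "\<And>Z. f Z = poly P Z" using assms(1) by blast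
  have "isCont (\<lambda>z. poly P (z\<^sup>2)) 0" by (intro continuous_intros)
  then have "((\<lambda>z. poly P (z\<^sup>2)) \<longlongrightarrow> f 0) (nhds 0)" by (simp add: continuous_at tendsto_nhds_iff P)
  then show ?thesis using assms(2) unfolding P by (rule tendsto_imp_eventually_ne)
qed

lemma ex_small_regular:
  "\<exists>\<delta>>0. \<forall>z. norm z < \<delta> \<longrightarrow> norm (z\<^sup>2) < 3/4 \<and> node (even_deg p) (z\<^sup>2) \<noteq> 0 \<and>
     node (odd_deg p) (z\<^sup>2) \<noteq> 0 \<and> cos_den p (z\<^sup>2) \<noteq> 0"
proof -
  have "eventually (\<lambda>z::complex. norm z < 1/2) (nhds 0)"
    using eventually_nhds_metric[of "\<lambda>z::complex. norm z < 1/2" 0] by (auto intro!: exI[of _ "1/2"])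
  then have "eventually (\<lambda>z::complex. norm (z\<^sup>2) < 3/4) (nhds 0)"
  proof (rule eventually_mono)
    fix z :: complex assume "norm z < 1/2"
    then have "(norm z)\<^sup>2 < (1/2)\<^sup>2" by (intro power_strict_mono) auto
    then show "norm (z\<^sup>2) < 3/4" by (simp add: norm_power power_divide)
  qed
  then have "eventually (\<lambda>z. norm (z\<^sup>2) < 3/4 \<and> node (even_deg p) (z\<^sup>2) \<noteq> 0 \<and>
       node (odd_deg p) (z\<^sup>2) \<noteq> 0 \<and> cos_den p (z\<^sup>2) \<noteq> 0) (nhds (0::complex))"
    by (intro eventually_conj eventually_poly_square_nonzero node_poly cos_den_poly values_at_0_nonzero)
  then show ?thesis by (simp add: eventually_nhds_metric)
qed

lemma ex_discrete_wave_iff: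
  fixes \<omega> k :: complex
  assumes p: "p \<ge> 1" and h: "h > 0"
  defines "z \<equiv> \<omega> * complex_of_real h"
  assumes reg: "norm (z\<^sup>2) < 3/4" "node (even_deg p) (z\<^sup>2) \<noteq> 0" "node (odd_deg p) (z\<^sup>2) \<noteq> 0"
    "cos_den p (z\<^sup>2) \<noteq> 0"
  shows "(\<exists>u. discrete_wave p h \<omega> k u) \<longleftrightarrow>
    cos (k * complex_of_real h) = cos_num p (z\<^sup>2) / cos_den p (z\<^sup>2)"
proof -
  define l where "l = exp (\<i> * k * complex_of_real h)"
  define c where "c = cos (k * complex_of_real h)"
  define X where "X = flux (odd_deg p) (z\<^sup>2) * node (even_deg p) (z\<^sup>2)"
  define Y where "Y = flux (even_deg p) (z\<^sup>2) * node (odd_deg p) (z\<^sup>2)"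
  have l: "l \<noteq> 0" by (simp add: l_def)
  have "2 * c = l + 1 / l"
    by (simp add: c_def l_def cos_exp_eq exp_minus inverse_eq_divide mult.assoc)
  then have "l\<^sup>2 + 1 = 2 * l * c" using l by (simp add: field_simps power2_eq_square)
  then have sq: "(1 + l)\<^sup>2 = 2 * l * (c + 1)" "(1 - l)\<^sup>2 = 2 * l * (c - 1)"
    by (simp_all add: power2_eq_square algebra_simps)
  have "(\<exists>u. discrete_wave p h \<omega> k u) \<longleftrightarrow> (\<exists>q. local_wave p (z\<^sup>2) l q)"
    using local_wave_of_discrete_wave[OF h p] discrete_wave_of_local_wave[OF h p]
    unfolding l_def z_def by metis
  also have "\<dots> \<longleftrightarrow> Y * (1 + l)\<^sup>2 = X * (1 - l)\<^sup>2"
    unfolding X_def Y_def by (rule ex_local_wave_iff[OF p reg(1) l reg(2,3)])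
  also have "\<dots> \<longleftrightarrow> (2 * l) * (Y * (c + 1)) = (2 * l) * (X * (c - 1))"
    unfolding sq by (simp only: mult_ac)
  also have "\<dots> \<longleftrightarrow> Y * (c + 1) = X * (c - 1)" using l by simp
  also have "\<dots> \<longleftrightarrow> c * (X - Y) = X + Y" by (auto simp: algebra_simps)
  also have "\<dots> \<longleftrightarrow> c = (X + Y) / (X - Y)"
    using reg(4) by (simp add: nonzero_eq_divide_eq cos_den_def X_def Y_def)
  finally show ?thesis by (simp add: c_def X_def Y_def cos_num_def cos_den_def)
qed

lemma poly_coprime_reduction:
  fixes A B :: "'a::field poly"
  assumes "B \<noteq> 0"
  shows "\<exists>P Q G. A = P * G \<and> B = Q * G \<and> coprime P Q"
  using assms
proof (induction "degree B" arbitrary: A B rule: less_induct)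
  case less
  show ?case
  proof (cases "coprime A B")
    case True
    then show ?thesis by (intro exI[of _ A] exI[of _ B] exI[of _ 1]) simp
  next
    case False
    then obtain c where c: "c dvd A" "c dvd B" "\<not> is_unit c" by (rule not_coprimeE)
    obtain A' B' where AB: "A = c * A'" "B = c * B'" using c(1,2) by (elim dvdE)
    have "c \<noteq> 0" "B' \<noteq> 0" using less.prems AB by auto
    moreover have "degree c > 0" using c(3) \<open>c \<noteq> 0\<close> by (simp add: is_unit_iff_degree)
    ultimately have "degree B' < degree B" by (simp add: AB degree_mult_eq)
    from less.hyps[OF this \<open>B' \<noteq> 0\<close>] obtain P Q G where
      "A' = P * G" "B' = Q * G" "coprime P Q" by blast
    then show ?thesis
      by (intro exI[of _ P] exI[of _ Q] exI[of _ "c * G"]) (simp add: AB mult_ac)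
  qed
qed

lemma rational_function_of_fraction:
  assumes "B \<noteq> 0"
  obtains R where "rational_function R" "\<And>z. poly B z \<noteq> 0 \<Longrightarrow> R z = poly A z / poly B z"
proof -
  obtain P Q G where PQ: "A = P * G" "B = Q * G" "coprime P Q"
    using poly_coprime_reduction[OF assms, of A] by blast
  have "Q \<noteq> 0" using PQ(2) assms by auto
  with PQ(3) have "rational_function (\<lambda>z. poly P z / poly Q z)"
    unfolding rational_function_def by blast
  moreover have "poly P z / poly Q z = poly A z / poly B z" if "poly B z \<noteq> 0" for z
  proof -
    have "poly A z = poly P z * poly G z" "poly B z = poly Q z * poly G z"
      using PQ(1,2) by (metis poly_mult)+
    with that show ?thesis by simp
  qed
  ultimately show ?thesis by (rule that)
qed

lemma rational_function_eqI:
  assumes "rational_function R" "rational_function S" "\<delta> > 0"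
    and eq: "\<And>z. norm z < \<delta> \<Longrightarrow> R z = S z"
  shows "R = S"
proof -
  obtain P Q where PQ: "Q \<noteq> 0" "coprime P Q" "\<And>z. R z = poly P z / poly Q z"
    using assms(1) unfolding rational_function_def by blast
  obtain P' Q' where PQ': "Q' \<noteq> 0" "coprime P' Q'" "\<And>z. S z = poly P' z / poly Q' z"
    using assms(2) unfolding rational_function_def by blast
  have "(P * Q' - P' * Q) * (Q * Q') = 0"
  proof (rule ccontr)
    assume "(P * Q' - P' * Q) * (Q * Q') \<noteq> 0"
    then have fin: "finite {z. poly ((P * Q' - P' * Q) * (Q * Q')) z = 0}" by (rule poly_roots_finite)
    have "ball 0 \<delta> \<subseteq> {z. poly ((P * Q' - P' * Q) * (Q * Q')) z = 0}"
    proof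
      fix z :: complex assume "z \<in> ball 0 \<delta>"
      then have "poly P z / poly Q z = poly P' z / poly Q' z"
        using eq[of z] by (simp add: PQ PQ')
      then show "z \<in> {z. poly ((P * Q' - P' * Q) * (Q * Q')) z = 0}"
        by (cases "poly Q z = 0 \<or> poly Q' z = 0") (auto simp: frac_eq_eq)
    qed
    with fin have "finite (ball (0::complex) \<delta>)" by (rule finite_subset[rotated])
    then show False using \<open>\<delta> > 0\<close> using uncountable_ball countable_finite by blast
  qed
  then have cross: "P * Q' = P' * Q" using PQ(1) PQ'(1) by simp
  show ?thesis
  proof
    fix z
    have x: "poly P z * poly Q' z = poly P' z * poly Q z"
      using cross by (metis poly_mult)
    have "poly P z \<noteq> 0 \<or> poly Q z \<noteq> 0" "poly P' z \<noteq> 0 \<or> poly Q' z \<noteq> 0"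
      using coprime_poly_0[OF PQ(2)] coprime_poly_0[OF PQ'(2)] by auto
    with x show "R z = S z"
      unfolding PQ PQ' by (cases "poly Q z = 0"; cases "poly Q' z = 0") (auto simp: frac_eq_eq)
  qed
qed

lemma is_numerical_cosine_unique:
  assumes "is_numerical_cosine p R" "is_numerical_cosine p S"
  shows "R = S"
proof -
  obtain \<delta> where d: "\<delta> > 0" "\<And>h \<omega> k. h > 0 \<Longrightarrow> norm (\<omega> * complex_of_real h) < \<delta> \<Longrightarrow>
       (\<exists>u. discrete_wave p h \<omega> k u) \<longleftrightarrow> cos (k * complex_of_real h) = R (\<omega> * complex_of_real h)"
    using assms(1) unfolding is_numerical_cosine_def by blast
  obtain \<epsilon> where e: "\<epsilon> > 0" "\<And>h \<omega> k. h > 0 \<Longrightarrow> norm (\<omega> * complex_of_real h) < \<epsilon> \<Longrightarrow>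
       (\<exists>u. discrete_wave p h \<omega> k u) \<longleftrightarrow> cos (k * complex_of_real h) = S (\<omega> * complex_of_real h)"
    using assms(2) unfolding is_numerical_cosine_def by blast
  show ?thesis
  proof (rule rational_function_eqI)
    show "rational_function R" "rational_function S"
      using assms by (simp_all add: is_numerical_cosine_def)
    show "min \<delta> \<epsilon> > 0" using d(1) e(1) by simp
    fix z :: complex assume "norm z < min \<delta> \<epsilon>"
    then show "R z = S z"
      \<comment> \<open>Since \<open>cos\<close> is onto, \<open>R z\<close> is the cosine of some wave number.\<close>
      using d(2)[of 1 z "Arccos (R z)"] e(2)[of 1 z "Arccos (R z)"] by (simp add: cos_Arccos)
  qed
qed

text \<open>Near the origin the numerical cosine is the quotient of \<open>cos_num\<close> and \<open>cos_den\<close>. The definition demands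
lowest terms, where the values away from the common roots are unchanged.\<close>

lemma numerical_cosine_eq:
  assumes p: "p \<ge> 1"
  obtains \<delta> where "\<delta> > 0" "\<And>z. norm z < \<delta> \<Longrightarrow> cos_den p (z\<^sup>2) \<noteq> 0"
    "\<And>z. norm z < \<delta> \<Longrightarrow> numerical_cosine p z = cos_num p (z\<^sup>2) / cos_den p (z\<^sup>2)"
proof -
  obtain \<delta> where d: "\<delta> > 0"
    "\<And>z. norm z < \<delta> \<Longrightarrow> norm (z\<^sup>2) < 3/4 \<and> node (even_deg p) (z\<^sup>2) \<noteq> 0 \<and>
       node (odd_deg p) (z\<^sup>2) \<noteq> 0 \<and> cos_den p (z\<^sup>2) \<noteq> 0"
    using ex_small_regular[of p] by blast
  obtain A B where A: "\<And>Z. cos_num p Z = poly A Z" and B: "\<And>Z. cos_den p Z = poly B Z"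
    using cos_num_poly cos_den_poly by metis
  define A2 where "A2 = pcompose A [:0, 0, 1:]"
  define B2 where "B2 = pcompose B [:0, 0, 1:]"
  have AB: "poly A2 z = cos_num p (z\<^sup>2)" "poly B2 z = cos_den p (z\<^sup>2)" for z
    by (simp_all add: A2_def B2_def poly_pcompose A B power2_eq_square)
  have "B2 \<noteq> 0" using AB(2)[of 0] values_at_0_nonzero(4)[of p] by auto
  then obtain R where R: "rational_function R" "\<And>z. poly B2 z \<noteq> 0 \<Longrightarrow> R z = poly A2 z / poly B2 z"
    by (rule rational_function_of_fraction[where A = A2]) blast
  have Rz: "R z = cos_num p (z\<^sup>2) / cos_den p (z\<^sup>2)" if "norm z < \<delta>" for z
    using R(2)[of z] d(2)[OF that] by (simp add: AB)
  have R': "is_numerical_cosine p R"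
    unfolding is_numerical_cosine_def
  proof (intro conjI R(1) exI[of _ \<delta>] d(1) allI impI)
    fix h :: real and \<omega> k :: complex
    assume "0 < h" and n: "norm (\<omega> * complex_of_real h) < \<delta>"
    show "(\<exists>u. discrete_wave p h \<omega> k u) \<longleftrightarrow> cos (k * complex_of_real h) = R (\<omega> * complex_of_real h)"
      unfolding Rz[OF n] using d(2)[OF n] by (intro ex_discrete_wave_iff p \<open>0 < h\<close>) blast+
  qed
  have "numerical_cosine p = R"
    unfolding numerical_cosine_def
    by (rule the_equality, rule R', erule is_numerical_cosine_unique[OF _ R'])
  then show ?thesis using that[of \<delta>] d Rz by blast
qed

section \<open>Asymptotics of the error\<close>

text \<open>With \<open>c = cos (z/2)\<close>, \<open>s = sin (z/2)\<close> and \<open>cos z = c\<^sup>2 - s\<^sup>2\<close>, the numerator of the error is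
\<open>2 (X s\<^sup>2 + Y c\<^sup>2)\<close>. The flux identities replace \<open>X s\<close> and \<open>Y c\<close>, and the main terms cancel.\<close>

lemma cos_error_identity:
  fixes z :: complex
  assumes "cos_den p (z\<^sup>2) \<noteq> 0"
  defines "e \<equiv> even_deg p" and "d \<equiv> odd_deg p"
  shows "cos_num p (z\<^sup>2) / cos_den p (z\<^sup>2) - cos z =
    (z ^ (2 * d + 3) * ((-1) ^ (d div 2) * node e (z\<^sup>2) * sin (z / 2) * moment d z)
     - z ^ (2 * e + 4) * ((-1) ^ (e div 2) * node d (z\<^sup>2) * cos (z / 2) * moment e z)) / cos_den p (z\<^sup>2)"
proof -
  define c s where "c = cos (z / 2)" and "s = sin (z / 2)"
  define X where "X = flux d (z\<^sup>2) * node e (z\<^sup>2)"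
  define Y where "Y = flux e (z\<^sup>2) * node d (z\<^sup>2)"
  have cs: "c\<^sup>2 + s\<^sup>2 = 1" by (simp add: c_def s_def)
  have "cos z = c\<^sup>2 - s\<^sup>2" using cos_double[of "z / 2"] by (simp add: c_def s_def)
  have num: "cos_num p (z\<^sup>2) = X + Y" and den: "cos_den p (z\<^sup>2) = X - Y"
    by (simp_all add: cos_num_def cos_den_def X_def Y_def e_def d_def)
  have E: "flux e (z\<^sup>2) * c = - z * node e (z\<^sup>2) * s - (-1) ^ (e div 2) / 2 * z ^ (2 * e + 4) * moment e z"
    using even_flux_identity[of "p div 2" z] by (simp add: e_def even_deg_def c_def s_def)
  have O: "flux d (z\<^sup>2) * s = z * node d (z\<^sup>2) * c + (-1) ^ (d div 2) / 2 * z ^ (2 * d + 3) * moment d z"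
    using odd_flux_identity[of "(p - 1) div 2" z] by (simp add: d_def odd_deg_def c_def s_def)
  have "X + Y - cos z * (X - Y) = X * (1 - c\<^sup>2 + s\<^sup>2) + Y * (1 + c\<^sup>2 - s\<^sup>2)"
    unfolding \<open>cos z = c\<^sup>2 - s\<^sup>2\<close> by (simp add: algebra_simps)
  also have "\<dots> = 2 * (node e (z\<^sup>2) * s * (flux d (z\<^sup>2) * s) + node d (z\<^sup>2) * c * (flux e (z\<^sup>2) * c))"
    unfolding cs[symmetric] X_def Y_def by (simp add: power2_eq_square algebra_simps)
  also have "\<dots> = z ^ (2 * d + 3) * ((-1) ^ (d div 2) * node e (z\<^sup>2) * s * moment d z)
     - z ^ (2 * e + 4) * ((-1) ^ (e div 2) * node d (z\<^sup>2) * c * moment e z)"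
    unfolding E O by (simp add: algebra_simps)
  finally have N: "X + Y - cos z * (X - Y) = z ^ (2 * d + 3) * ((-1) ^ (d div 2) * node e (z\<^sup>2) * s * moment d z)
     - z ^ (2 * e + 4) * ((-1) ^ (e div 2) * node d (z\<^sup>2) * c * moment e z)" .
  have "(X + Y) / (X - Y) - cos z = (X + Y - cos z * (X - Y)) / (X - Y)"
    using assms(1) den by (simp add: diff_divide_distrib)
  then show ?thesis by (simp only: num den N c_def s_def)
qed

text \<open>\<open>f z = L + O(z\<^sup>2)\<close> as \<open>z\<close> tends to zero through nonzero values.\<close>

definition quad_close :: "(complex \<Rightarrow> complex) \<Rightarrow> complex \<Rightarrow> bool" where
  "quad_close f L \<longleftrightarrow> (\<lambda>z. f z - L) \<in> O[at 0](\<lambda>z. z\<^sup>2)"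

lemma quad_close_tendsto:
  assumes "quad_close f L"
  shows "(f \<longlongrightarrow> L) (at 0)"
proof -
  have "((\<lambda>z::complex. z\<^sup>2) \<longlongrightarrow> 0) (at 0)"
    by (auto intro!: tendsto_eq_intros)
  then have "(\<lambda>z::complex. z\<^sup>2) \<in> o[at 0](\<lambda>_. 1)"
    by (intro smalloI_tendsto) simp_all
  then have "(\<lambda>z. f z - L) \<in> o[at 0](\<lambda>_. 1)"
    using assms unfolding quad_close_def by (rule landau_o.big_small_trans[rotated])
  then have "((\<lambda>z. f z - L) \<longlongrightarrow> 0) (at 0)" using smalloD_tendsto by fastforce
  then show ?thesis by (simp add: Lim_null[symmetric])
qed

lemma quad_close_bounded: "quad_close f L \<Longrightarrow> f \<in> O[at 0](\<lambda>_. 1)"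
  using quad_close_tendsto[of f L] by (intro bigoI_tendsto[where c = L]) simp_all

lemma quad_close_const: "quad_close (\<lambda>_. c) c"
  by (simp add: quad_close_def)

lemma quad_close_mult:
  assumes "quad_close f L" "quad_close g M"
  shows "quad_close (\<lambda>z. f z * g z) (L * M)"
proof -
  have "(\<lambda>z. (f z - L) * g z) \<in> O[at 0](\<lambda>z. z\<^sup>2 * 1)"
    using assms quad_close_bounded[OF assms(2)] unfolding quad_close_def by (intro landau_o.big.mult)
  moreover have "(\<lambda>z. L * (g z - M)) \<in> O[at 0](\<lambda>z. z\<^sup>2)"
    using assms(2) unfolding quad_close_def by (cases "L = 0") simp_all
  ultimately have "(\<lambda>z. (f z - L) * g z + L * (g z - M)) \<in> O[at 0](\<lambda>z. z\<^sup>2)"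
    by (intro sum_in_bigo) simp_all
  then show ?thesis by (simp add: quad_close_def algebra_simps)
qed

lemma quad_close_inverse:
  assumes g: "quad_close g M" and M: "M \<noteq> 0"
  shows "quad_close (\<lambda>z. inverse (g z)) (inverse M)"
proof -
  have lim: "(g \<longlongrightarrow> M) (at 0)" by (rule quad_close_tendsto[OF g])
  then have ne: "eventually (\<lambda>z. g z \<noteq> 0) (at 0)" using M by (rule tendsto_imp_eventually_ne)
  have "((\<lambda>z. inverse (g z) * - inverse M) \<longlongrightarrow> inverse M * - inverse M) (at 0)"
    by (intro tendsto_intros lim M)
  then have "(\<lambda>z. inverse (g z) * - inverse M) \<in> O[at 0](\<lambda>_. 1)"
    by (intro bigoI_tendsto[where c = "inverse M * - inverse M"]) simp_all
  then have "(\<lambda>z. (g z - M) * (inverse (g z) * - inverse M)) \<in> O[at 0](\<lambda>z. z\<^sup>2 * 1)"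
    using g unfolding quad_close_def by (rule landau_o.big.mult[rotated])
  moreover have "eventually (\<lambda>z. (g z - M) * (inverse (g z) * - inverse M) = inverse (g z) - inverse M) (at 0)"
    using ne by eventually_elim (use M in \<open>simp add: field_simps\<close>)
  ultimately show ?thesis
    unfolding quad_close_def by (simp only: landau_o.big.in_cong mult_1_right)
qed

lemma quad_close_poly_square:
  assumes "\<exists>P. \<forall>Z. f Z = poly P Z"
  shows "quad_close (\<lambda>z. f (z\<^sup>2)) (f 0)"
proof -
  obtain P where P: "\<And>Z. f Z = poly P Z" using assms by blast
  obtain a Q where "P = pCons a Q" by (rule pCons_cases)
  then have eq: "f (z\<^sup>2) - f 0 = z\<^sup>2 * poly Q (z\<^sup>2)" for z by (simp add: P)
  have "isCont (\<lambda>z. poly Q (z\<^sup>2)) 0" by (intro continuous_intros)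
  then have "(\<lambda>z. poly Q (z\<^sup>2)) \<in> O[at 0](\<lambda>_. 1)"
    by (intro bigoI_tendsto[where c = "poly Q (0\<^sup>2)"]) (simp_all add: isCont_def)
  then have "(\<lambda>z. z\<^sup>2 * poly Q (z\<^sup>2)) \<in> O[at 0](\<lambda>z. z\<^sup>2 * 1)"
    by (intro landau_o.big.mult) simp_all
  then show ?thesis by (simp add: quad_close_def eq)
qed

lemma eventually_norm_le_1: "eventually (\<lambda>z::complex. norm z \<le> 1) (at 0)"
  unfolding eventually_at by (intro exI[of _ 1]) auto

lemma exp_Im_half_le:
  fixes z :: complex
  assumes "norm z \<le> 1"
  shows "exp \<bar>Im (z / 2)\<bar> \<le> exp 1"
  using abs_Im_le_cmod[of z] assms by simp

lemma quad_close_moment: "quad_close (moment d) (moment d 0)"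
  unfolding quad_close_def
  by (rule bigoI[where c = "exp 1"])
    (use eventually_norm_le_1 in eventually_elim, simp add: norm_power moment_quadratic)

lemma quad_close_cos_half: "quad_close (\<lambda>z. cos (z / 2)) 1"
  unfolding quad_close_def
proof (rule bigoI[where c = "exp 1"])
  show "eventually (\<lambda>z. norm (cos (z / 2) - 1) \<le> exp 1 * norm (z\<^sup>2)) (at (0::complex))"
    using eventually_norm_le_1
  proof eventually_elim
    case (elim z)
    have "norm (cos (z / 2) - 1) \<le> exp \<bar>Im (z / 2)\<bar> * norm (z / 2) ^ 2"
      using Taylor_cos[of "z / 2" 1] by (simp add: cos_coeff_def numeral_2_eq_2)
    also have "\<dots> \<le> exp 1 * norm z ^ 2"
      by (intro mult_mono exp_Im_half_le elim power_mono) (auto simp: norm_divide)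
    finally show ?case by (simp add: norm_power)
  qed
qed

lemma quad_close_sin_half: "quad_close (\<lambda>z. sin (z / 2) / z) (1/2)"
  unfolding quad_close_def
proof (rule bigoI[where c = "exp 1"])
  have "eventually (\<lambda>z::complex. z \<noteq> 0) (at 0)" by (simp add: eventually_at_filter)
  with eventually_norm_le_1
  show "eventually (\<lambda>z. norm (sin (z / 2) / z - 1/2) \<le> exp 1 * norm (z\<^sup>2)) (at (0::complex))"
  proof eventually_elim
    case (elim z)
    have "norm (sin (z / 2) - z / 2) \<le> exp \<bar>Im (z / 2)\<bar> * norm (z / 2) ^ 3 / 2"
      using Taylor_sin[of "z / 2" 2] by (simp add: sin_coeff_def numeral_2_eq_2 numeral_3_eq_3)
    also have "\<dots> \<le> exp \<bar>Im (z / 2)\<bar> * norm (z / 2) ^ 3" by simp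
    also have "\<dots> \<le> exp 1 * norm z ^ 3"
      by (intro mult_mono exp_Im_half_le elim power_mono) (auto simp: norm_divide)
    finally have "norm (sin (z / 2) - z / 2) / norm z \<le> exp 1 * norm z ^ 3 / norm z"
      by (rule divide_right_mono) simp
    moreover have "sin (z / 2) / z - 1/2 = (sin (z / 2) - z / 2) / z"
      using elim by (simp add: diff_divide_distrib)
    moreover have "exp 1 * norm z ^ 3 / norm z = exp 1 * norm (z\<^sup>2)"
      using elim by (simp add: norm_power norm_mult power2_eq_square power3_eq_cube)
    ultimately show ?case by (simp only: norm_divide)
  qed
qed

text \<open>The contribution of degree \<open>d\<close> to the error, divided by \<open>z^(2d+4)\<close>. In the odd case one factor \<open>z\<close>
comes from the sine.\<close>

definition err_coeff :: "nat \<Rightarrow> nat \<Rightarrow> complex \<Rightarrow> complex" where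
  "err_coeff p d z =
    (if even d then - ((-1) ^ (d div 2)) * node (odd_deg p) (z\<^sup>2) * cos (z / 2) * moment d z
     else (-1) ^ (d div 2) * node (even_deg p) (z\<^sup>2) * (sin (z / 2) / z) * moment d z)
    * inverse (cos_den p (z\<^sup>2))"

lemma moment_ratio:
  "moment d 0 / (2 * fact (2 * d + 2)) =
    (-1) ^ (d + 1) * (1/2 * (fact (d + 1) / fact (2 * (d + 1)))\<^sup>2 / of_nat (2 * (d + 1) + 1))"
proof -
  have e: "2 * d + 3 = Suc (2 * (d + 1))" "2 * d + 2 = 2 * (d + 1)" by simp_all
  show ?thesis
    unfolding moment_at_0 e fact_Suc by (simp add: power2_eq_square del: fact_Suc)
qed

text \<open>Both parities lead to the same limit at zero. For \<open>d = p - 1\<close> it is the constant in the error formula.\<close>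

lemma quad_close_err_coeff:
  assumes "d = even_deg p \<or> d = odd_deg p"
  shows "quad_close (err_coeff p d)
    (1/2 * (fact (d + 1) / fact (2 * (d + 1)))\<^sup>2 / of_nat (2 * (d + 1) + 1))"
proof (cases "even d")
  case True
  then have d: "d = even_deg p" using assms by auto
  have "quad_close (err_coeff p d)
      (- ((-1) ^ (d div 2)) * node (odd_deg p) 0 * 1 * moment d 0 * inverse (cos_den p 0))"
    unfolding err_coeff_def if_P[OF True]
    by (intro quad_close_mult quad_close_const quad_close_inverse quad_close_cos_half quad_close_moment
        quad_close_poly_square node_poly cos_den_poly values_at_0_nonzero)
  also have "- ((-1) ^ (d div 2)) * node (odd_deg p) 0 * 1 * moment d 0 * inverse (cos_den p 0)
      = - (moment d 0 / (2 * fact (2 * d + 2)))"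
  proof -
    have cancel: "- s * (f / 2) * 1 * t * inverse (f * (s * F)) = - (t / (2 * F))"
      if "s \<noteq> 0" "f \<noteq> 0" "F \<noteq> 0" for s f t F :: complex
      using that by (simp add: field_simps)
    show ?thesis
      unfolding cos_den_at_0 odd_deg_at_0(1) even_deg_at_0(1) d
      by (rule cancel[OF power_not_zero values_at_0_nonzero(2) fact_nonzero]) simp
  qed
  finally show ?thesis unfolding moment_ratio using True by simp
next
  case False
  then have d: "d = odd_deg p" using assms by auto
  have "quad_close (err_coeff p d)
      ((-1) ^ (d div 2) * node (even_deg p) 0 * (1/2) * moment d 0 * inverse (cos_den p 0))"
    unfolding err_coeff_def if_not_P[OF False]
    by (intro quad_close_mult quad_close_const quad_close_inverse quad_close_sin_half quad_close_moment
        quad_close_poly_square node_poly cos_den_poly values_at_0_nonzero)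
  also have "(-1) ^ (d div 2) * node (even_deg p) 0 * (1/2) * moment d 0 * inverse (cos_den p 0)
      = moment d 0 / (2 * fact (2 * d + 2))"
  proof -
    have cancel: "s * n * (1/2) * t * inverse (s * F * n) = t / (2 * F)"
      if "s \<noteq> 0" "n \<noteq> 0" "F \<noteq> 0" for s n t F :: complex
      using that by (simp add: field_simps)
    show ?thesis
      unfolding cos_den_at_0 odd_deg_at_0(2) d
      by (rule cancel[OF power_not_zero values_at_0_nonzero(1) fact_nonzero]) simp
  qed
  finally show ?thesis unfolding moment_ratio using False by simp
qed

lemma cos_error_expansion:
  assumes p: "p \<ge> 1" and "cos_den p (z\<^sup>2) \<noteq> 0"
  shows "cos_num p (z\<^sup>2) / cos_den p (z\<^sup>2) - cos z =
    z ^ (2 * p + 2) * err_coeff p (p - 1) z + z ^ (2 * p + 4) * err_coeff p p z"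
proof -
  let ?e = "even_deg p" and ?d = "odd_deg p"
  have "cos_num p (z\<^sup>2) / cos_den p (z\<^sup>2) - cos z =
      z ^ (2 * ?e + 4) * err_coeff p ?e z + z ^ (2 * ?d + 4) * err_coeff p ?d z"
  proof (cases "z = 0")
    case False
    have "2 * ?d + 4 = Suc (2 * ?d + 3)" by simp
    then have "z ^ (2 * ?d + 4) * (sin (z / 2) / z) = z ^ (2 * ?d + 3) * sin (z / 2)"
      using False by (simp only: power_Suc2) simp
    moreover have "z ^ (2 * ?d + 4) * err_coeff p ?d z = z ^ (2 * ?d + 4) * (sin (z / 2) / z) *
        ((-1) ^ (?d div 2) * node ?e (z\<^sup>2) * moment ?d z * inverse (cos_den p (z\<^sup>2)))"
      unfolding err_coeff_def by (simp only: even_odd_deg if_False mult_ac)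
    ultimately have "z ^ (2 * ?d + 4) * err_coeff p ?d z =
        z ^ (2 * ?d + 3) * ((-1) ^ (?d div 2) * node ?e (z\<^sup>2) * sin (z / 2) * moment ?d z)
        / cos_den p (z\<^sup>2)"
      by (simp only: divide_inverse mult_ac)
    moreover have "z ^ (2 * ?e + 4) * err_coeff p ?e z =
        - (z ^ (2 * ?e + 4) * ((-1) ^ (?e div 2) * node ?d (z\<^sup>2) * cos (z / 2) * moment ?e z))
        / cos_den p (z\<^sup>2)"
      unfolding err_coeff_def by (simp only: even_odd_deg if_True divide_inverse mult_minus_left mult_minus_right mult_ac)
    ultimately show ?thesis
      unfolding cos_error_identity[OF assms(2)] by (simp add: diff_divide_distrib)
  next
    case True
    then show ?thesis
      unfolding cos_error_identity[OF assms(2)] by (simp add: power_0_left)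
  qed
  moreover have "2 * (p - 1) + 4 = 2 * p + 2" using p by simp
  ultimately show ?thesis
    using degrees_eq[OF p] by (elim disjE conjE) (simp_all only: add.commute[of "z ^ (2 * p + 4) * _"])
qed

theorem theorem2:
  fixes p :: nat
  assumes "p \<ge> 1"
  shows "\<exists>C. \<exists>\<delta>>0. \<forall>h::real. \<forall>\<omega>::complex.
    h > 0 \<and> norm (\<omega> * of_real h) < \<delta> \<longrightarrow>
    norm (numerical_cosine p (\<omega> * of_real h) - cos (\<omega> * of_real h)
          - 1 / 2 * (fact p / fact (2 * p))\<^sup>2
              * ((\<omega> * of_real h) ^ (2 * p + 2) / of_nat (2 * p + 1)))
      \<le> C * norm (\<omega> * of_real h) ^ (2 * p + 4)"
proof -
  obtain \<delta> where d: "\<delta> > 0" and den: "\<And>z. norm z < \<delta> \<Longrightarrow> cos_den p (z\<^sup>2) \<noteq> 0"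
    and nc: "\<And>z. norm z < \<delta> \<Longrightarrow> numerical_cosine p z = cos_num p (z\<^sup>2) / cos_den p (z\<^sup>2)"
    by (rule numerical_cosine_eq[OF assms]) blast
  define a :: complex where "a = 1/2 * (fact p / fact (2 * p))\<^sup>2 / of_nat (2 * p + 1)"
  define E where "E z = z ^ (2 * p + 2) * (err_coeff p (p - 1) z - a) + z ^ (2 * p + 4) * err_coeff p p z" for z
  have err: "numerical_cosine p z - cos z
      - 1 / 2 * (fact p / fact (2 * p))\<^sup>2 * (z ^ (2 * p + 2) / of_nat (2 * p + 1)) = E z"
    if "norm z < \<delta>" for z
  proof -
    have "numerical_cosine p z - cos z
      = z ^ (2 * p + 2) * err_coeff p (p - 1) z + z ^ (2 * p + 4) * err_coeff p p z"
      unfolding nc[OF that] by (rule cos_error_expansion[OF assms den[OF that]])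
    moreover have "1 / 2 * (fact p / fact (2 * p))\<^sup>2 * (z ^ (2 * p + 2) / of_nat (2 * p + 1))
        = z ^ (2 * p + 2) * a"
      by (simp add: a_def)
    ultimately show ?thesis by (simp add: E_def right_diff_distrib)
  qed
  have degs: "p - 1 = even_deg p \<or> p - 1 = odd_deg p" "p = even_deg p \<or> p = odd_deg p"
    using degrees_eq[OF assms] by auto
  have "p - 1 + 1 = p" using assms by simp
  then have "quad_close (err_coeff p (p - 1)) a"
    using quad_close_err_coeff[OF degs(1)] by (simp only: a_def)
  then have "(\<lambda>z. z ^ (2 * p + 2) * (err_coeff p (p - 1) z - a)) \<in> O[at 0](\<lambda>z. z ^ (2 * p + 2) * z\<^sup>2)"
    unfolding quad_close_def by (intro landau_o.big.mult) simp_all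
  also have "(\<lambda>z::complex. z ^ (2 * p + 2) * z\<^sup>2) = (\<lambda>z. z ^ (2 * p + 4))"
  proof -
    have "2 * p + 4 = 2 * p + 2 + 2" by simp
    then show ?thesis by (simp only: power_add)
  qed
  finally have 1: "(\<lambda>z. z ^ (2 * p + 2) * (err_coeff p (p - 1) z - a)) \<in> O[at 0](\<lambda>z. z ^ (2 * p + 4))" .
  have "(\<lambda>z. z ^ (2 * p + 4) * err_coeff p p z) \<in> O[at 0](\<lambda>z. z ^ (2 * p + 4) * 1)"
    using quad_close_bounded[OF quad_close_err_coeff[OF degs(2)]] by (intro landau_o.big.mult) simp_all
  with 1 have "E \<in> O[at 0](\<lambda>z. z ^ (2 * p + 4))"
    unfolding E_def by (intro sum_in_bigo) simp_all
  then obtain C where "eventually (\<lambda>z. norm (E z) \<le> C * norm (z ^ (2 * p + 4))) (at 0)"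
    by (rule landau_o.bigE)
  then obtain \<epsilon> where e: "\<epsilon> > 0"
    "\<And>z. z \<noteq> 0 \<Longrightarrow> norm z < \<epsilon> \<Longrightarrow> norm (E z) \<le> C * norm (z ^ (2 * p + 4))"
    unfolding eventually_at by auto
  have bound: "norm (E z) \<le> C * norm z ^ (2 * p + 4)" if "norm z < \<epsilon>" for z
    using e(2)[OF _ that] by (cases "z = 0") (simp_all add: E_def norm_power power_0_left)
  show ?thesis
  proof (rule exI[of _ C], rule exI[of _ "min \<delta> \<epsilon>"], intro conjI allI impI)
    show "min \<delta> \<epsilon> > 0" using d e(1) by simp
    fix h :: real and \<omega> :: complex
    assume "h > 0 \<and> norm (\<omega> * of_real h) < min \<delta> \<epsilon>"
    then have small: "norm (\<omega> * of_real h) < \<delta>" "norm (\<omega> * of_real h) < \<epsilon>" by simp_all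
    show "norm (numerical_cosine p (\<omega> * of_real h) - cos (\<omega> * of_real h)
          - 1 / 2 * (fact p / fact (2 * p))\<^sup>2
              * ((\<omega> * of_real h) ^ (2 * p + 2) / of_nat (2 * p + 1)))
      \<le> C * norm (\<omega> * of_real h) ^ (2 * p + 4)"
      unfolding err[OF small(1)] by (rule bound[OF small(2)])
  qed
qed

end
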